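(* Let $0<p<2$, $0<q<\infty$, and $p\neq q$. Then $L_{p,q}(0,\infty)$ does not embed isomorphically into $L_{p,q}(0,1)$. In particular, the two spaces are not isomorphic.
   Context: For $I=(0,1)$ or $I=(0,\infty)$ with Lebesgue measure $m$ and a measurable scalar function $f$ on $I$, $f^*(t)=\inf\{\lambda>0:m\{|f|>\lambda\}\le t\}$, $t>0$. For $0<p,q<\infty$, $L_{p,q}(I)$ is the space of measurable $f$ on $I$ with $\|f\|_{p,q}=\left(\int_0^\infty [t^{1/p}f^*(t)]^q\,\frac{dt}{t}\right)^{1/q}<\infty$ (a quasi-norm). A quasi-Banach space $X$ embeds isomorphically into $Y$ if there are a linear map $T:X\to Y$ and $C\ge1$ with $C^{-1}\|x\|_X\le\|Tx\|_Y\le C\|x\|_X$ for all $x\in X$; $X$ and $Y$ are isomorphic if such a $T$ can be chosen onto. *)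

theory Defs
  imports "HOL-Analysis.Analysis"
begin

section \<open>Linear embeddings between spaces with a (quasi-)norm\<close>

record ('k, 'v) normed_sp =
  points :: "'v set"
  plus_sp :: "'v \<Rightarrow> 'v \<Rightarrow> 'v"
  scale_sp :: "'k \<Rightarrow> 'v \<Rightarrow> 'v"
  norm_sp :: "'v \<Rightarrow> real"

definition linear_map_sp :: "('k, 'v) normed_sp \<Rightarrow> ('k, 'w) normed_sp \<Rightarrow> ('v \<Rightarrow> 'w) \<Rightarrow> bool" where
  "linear_map_sp X Y T \<longleftrightarrow>
     T ` points X \<subseteq> points Y \<and>
     (\<forall>x\<in>points X. \<forall>y\<in>points X. T (plus_sp X x y) = plus_sp Y (T x) (T y)) \<and>
     (\<forall>c. \<forall>x\<in>points X. T (scale_sp X c x) = scale_sp Y c (T x))"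

definition isomorphic_embedding_sp ::
  "('k, 'v) normed_sp \<Rightarrow> ('k, 'w) normed_sp \<Rightarrow> ('v \<Rightarrow> 'w) \<Rightarrow> bool" where
  "isomorphic_embedding_sp X Y T \<longleftrightarrow>
     linear_map_sp X Y T \<and>
     (\<exists>C\<ge>1. \<forall>x\<in>points X.
        inverse C * norm_sp X x \<le> norm_sp Y (T x) \<and> norm_sp Y (T x) \<le> C * norm_sp X x)"

definition embeds_isomorphically :: "('k, 'v) normed_sp \<Rightarrow> ('k, 'w) normed_sp \<Rightarrow> bool" where
  "embeds_isomorphically X Y \<longleftrightarrow> (\<exists>T. isomorphic_embedding_sp X Y T)"

definition isomorphic_sp :: "('k, 'v) normed_sp \<Rightarrow> ('k, 'w) normed_sp \<Rightarrow> bool" where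
  "isomorphic_sp X Y \<longleftrightarrow>
     (\<exists>T. isomorphic_embedding_sp X Y T \<and> T ` points X = points Y)"


section \<open>Lorentz spaces\<close>

text \<open>
  The decreasing rearrangement takes the value \<open>top\<close> where the set of admissible
  levels is empty, which can happen on an interval of infinite measure.
\<close>

definition rearrangement :: "real set \<Rightarrow> (real \<Rightarrow> 'k::real_normed_vector) \<Rightarrow> real \<Rightarrow> ennreal" where
  "rearrangement I f t =
     Inf {ennreal l | l. l > 0 \<and> emeasure (lebesgue_on I) {x \<in> I. norm (f x) > l} \<le> ennreal t}"

text \<open>Real powers on \<open>[0,\<infinity>]\<close>; only used with a positive exponent.\<close>

definition ennreal_powr :: "ennreal \<Rightarrow> real \<Rightarrow> ennreal" where
  "ennreal_powr x a = (if x = top then top else ennreal (enn2real x powr a))"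

definition lorentz_norm ::
  "real \<Rightarrow> real \<Rightarrow> real set \<Rightarrow> (real \<Rightarrow> 'k::real_normed_vector) \<Rightarrow> ennreal" where
  "lorentz_norm p q I f =
     ennreal_powr
       (\<integral>\<^sup>+ t\<in>{0<..}. ennreal_powr (ennreal (t powr (1 / p)) * rearrangement I f t) q * ennreal (1 / t) \<partial>lborel)
       (1 / q)"

definition lorentz_functions ::
  "real \<Rightarrow> real \<Rightarrow> real set \<Rightarrow> (real \<Rightarrow> 'k::real_normed_vector) set" where
  "lorentz_functions p q I =
     {f \<in> borel_measurable (lebesgue_on I). lorentz_norm p q I f < top}"

text \<open>
  Elements of the space are classes of functions that agree almost everywhere on \<open>I\<close>;
  in particular, values outside \<open>I\<close> play no role.
\<close>

definition ae_class :: "real set \<Rightarrow> (real \<Rightarrow> 'k::real_normed_vector) \<Rightarrow> (real \<Rightarrow> 'k) set" where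
  "ae_class I f = {g \<in> borel_measurable (lebesgue_on I). AE x in lebesgue_on I. g x = f x}"

text \<open>
  The scalar field is \<open>\<real>\<close> or \<open>\<complex>\<close>: up to isomorphism these are the only instances of the
  class constraint on \<open>'k\<close>.
  The operations and the norm are lifted to classes through arbitrary representatives;
  the lemmas below confirm that the result does not depend on them.
\<close>

definition lorentz_space ::
  "real \<Rightarrow> real \<Rightarrow> real set \<Rightarrow> ('k::{euclidean_space, real_normed_field}, (real \<Rightarrow> 'k) set) normed_sp" where
  "lorentz_space p q I =
     \<lparr>points = ae_class I ` lorentz_functions p q I,
      plus_sp = (\<lambda>A B. \<Union>f\<in>A. \<Union>g\<in>B. ae_class I (\<lambda>x. f x + g x)),
      scale_sp = (\<lambda>c A. \<Union>f\<in>A. ae_class I (\<lambda>x. c * f x)),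
      norm_sp = (\<lambda>A. the_elem ((\<lambda>f. enn2real (lorentz_norm p q I f)) ` A))\<rparr>"

lemma ae_class_self: "f \<in> borel_measurable (lebesgue_on I) \<Longrightarrow> f \<in> ae_class I f"
  by (simp add: ae_class_def)

lemma ae_class_cong:
  assumes "AE x in lebesgue_on I. f x = g x"
  shows "ae_class I f = ae_class I g"
proof -
  have "(AE x in lebesgue_on I. h x = f x) \<longleftrightarrow> (AE x in lebesgue_on I. h x = g x)" for h
  proof
    assume "AE x in lebesgue_on I. h x = f x"
    with assms show "AE x in lebesgue_on I. h x = g x"
      by eventually_elim simp
  next
    assume "AE x in lebesgue_on I. h x = g x"
    with assms show "AE x in lebesgue_on I. h x = f x"
      by eventually_elim simp
  qed
  then show ?thesis
    by (simp add: ae_class_def)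
qed

lemma rearrangement_cong_AE:
  fixes f g :: "real \<Rightarrow> 'k::real_normed_vector"
  assumes "f \<in> borel_measurable (lebesgue_on I)" "g \<in> borel_measurable (lebesgue_on I)"
    and "AE x in lebesgue_on I. f x = g x"
  shows "rearrangement I f t = rearrangement I g t"
proof -
  have meas: "{x \<in> I. norm (h x) > l} \<in> sets (lebesgue_on I)"
    if "h \<in> borel_measurable (lebesgue_on I)" for h :: "real \<Rightarrow> 'k" and l
  proof -
    have "{x \<in> space (lebesgue_on I). norm (h x) > l} \<in> sets (lebesgue_on I)"
      using measurable_compose[OF that borel_measurable_norm]
      by (simp only: borel_measurable_iff_greater)
    then show ?thesis by simp
  qed
  have "emeasure (lebesgue_on I) {x \<in> I. norm (f x) > l}
      = emeasure (lebesgue_on I) {x \<in> I. norm (g x) > l}" for l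
  proof (rule emeasure_eq_AE)
    show "AE x in lebesgue_on I. x \<in> {x \<in> I. norm (f x) > l} \<longleftrightarrow> x \<in> {x \<in> I. norm (g x) > l}"
      using assms(3) by eventually_elim simp
  qed (use assms meas in blast)+
  then show ?thesis
    by (simp add: rearrangement_def)
qed

lemma lorentz_norm_cong_AE:
  assumes "f \<in> borel_measurable (lebesgue_on I)" "g \<in> borel_measurable (lebesgue_on I)"
    and "AE x in lebesgue_on I. f x = g x"
  shows "lorentz_norm p q I f = lorentz_norm p q I g"
  using rearrangement_cong_AE[OF assms] by (simp add: lorentz_norm_def)

lemma plus_lorentz_space:
  assumes "f \<in> borel_measurable (lebesgue_on I)" "g \<in> borel_measurable (lebesgue_on I)"
  shows "plus_sp (lorentz_space p q I) (ae_class I f) (ae_class I g) = ae_class I (\<lambda>x. f x + g x)"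
proof -
  have "ae_class I (\<lambda>x. f' x + g' x) = ae_class I (\<lambda>x. f x + g x)"
    if "f' \<in> ae_class I f" "g' \<in> ae_class I g" for f' g'
  proof (rule ae_class_cong)
    have "AE x in lebesgue_on I. f' x = f x" "AE x in lebesgue_on I. g' x = g x"
      using that unfolding ae_class_def by blast+
    then show "AE x in lebesgue_on I. f' x + g' x = f x + g x"
      by eventually_elim simp
  qed
  then have "plus_sp (lorentz_space p q I) (ae_class I f) (ae_class I g)
      = (\<Union>f'\<in>ae_class I f. \<Union>g'\<in>ae_class I g. ae_class I (\<lambda>x. f x + g x))"
    unfolding lorentz_space_def normed_sp.select_convs by (intro SUP_cong refl)
  also have "\<dots> = ae_class I (\<lambda>x. f x + g x)"
    using ae_class_self[OF assms(1)] ae_class_self[OF assms(2)] by blast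
  finally show ?thesis .
qed

lemma scale_lorentz_space:
  assumes "f \<in> borel_measurable (lebesgue_on I)"
  shows "scale_sp (lorentz_space p q I) c (ae_class I f) = ae_class I (\<lambda>x. c * f x)"
proof -
  have "ae_class I (\<lambda>x. c * f' x) = ae_class I (\<lambda>x. c * f x)" if "f' \<in> ae_class I f" for f'
  proof (rule ae_class_cong)
    have "AE x in lebesgue_on I. f' x = f x"
      using that unfolding ae_class_def by blast+
    then show "AE x in lebesgue_on I. c * f' x = c * f x"
      by eventually_elim simp
  qed
  then have "scale_sp (lorentz_space p q I) c (ae_class I f)
      = (\<Union>f'\<in>ae_class I f. ae_class I (\<lambda>x. c * f x))"
    unfolding lorentz_space_def normed_sp.select_convs by (intro SUP_cong refl)
  also have "\<dots> = ae_class I (\<lambda>x. c * f x)"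
    using ae_class_self[OF assms] by blast
  finally show ?thesis .
qed

lemma norm_lorentz_space:
  assumes "f \<in> borel_measurable (lebesgue_on I)"
  shows "norm_sp (lorentz_space p q I) (ae_class I f) = enn2real (lorentz_norm p q I f)"
proof -
  have "lorentz_norm p q I f' = lorentz_norm p q I f" if "f' \<in> ae_class I f" for f'
  proof (rule lorentz_norm_cong_AE)
    show "f' \<in> borel_measurable (lebesgue_on I)" "AE x in lebesgue_on I. f' x = f x"
      using that unfolding ae_class_def by blast+
  qed (fact assms)
  then have "(\<lambda>f. enn2real (lorentz_norm p q I f)) ` ae_class I f
      = (\<lambda>_. enn2real (lorentz_norm p q I f)) ` ae_class I f"
    by (intro image_cong refl) (rule arg_cong[where f = enn2real])
  also have "\<dots> = {enn2real (lorentz_norm p q I f)}"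
    using ae_class_self[OF assms] by blast
  finally show ?thesis
    unfolding lorentz_space_def normed_sp.select_convs by simp
qed

end

theory Submission
  imports Defs "HOL-Library.Diagonal_Subsequence" "HOL-Probability.Hoeffding"
begin

text \<open>
  Put \<open>s = q / p\<close>, and let \<open>x\<^sub>n\<close> be the image of the indicator of \<open>(n, n + 1]\<close> under an embedding. Since
  \<open>k\<close> disjoint unit indicators span a signed sum of norm comparable to \<open>k powr (1 / p)\<close>, the quantity
  \<open>\<Sum>j. 2 powr (q * j) * m {\<bar>f\<bar> > 2 ^ j} powr s\<close>, which on \<open>(0, 1)\<close> is comparable to the \<open>q\<close>-th
  power of the norm (up to an additive constant), would be comparable to \<open>k powr s\<close> for every sum \<open>f\<close>
  of \<open>k\<close> of the \<open>\<plusminus> x\<^sub>n\<close>.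

  The mean of \<open>m {\<bar>f\<bar> > 2 ^ j} powr s\<close> over the signs is at most a multiple of
  \<open>(min 1 (\<Sum>n. \<integral> min 1 (\<bar>x\<^sub>n\<bar>\<^sup>2 / 4 ^ j))) powr s\<close>, where \<open>p < 2\<close> lets a Hardy inequality return
  from the truncated second moments to the distribution functions. A gliding hump argument extracts a
  subsequence whose distribution functions are dominated by one fixed function except on pairwise
  disjoint blocks of levels. The dominated part contributes \<open>o (k powr s)\<close>. The blocks contribute
  \<open>O (k)\<close>, which is negligible if \<open>s > 1\<close>; if \<open>s < 1\<close>, the upper bound \<open>k powr s\<close> forces all but
  finitely many blocks to be small, so they can be made to contribute \<open>O (1)\<close>. Either way the
  lower bound \<open>k powr s\<close> fails for large \<open>k\<close>.
\<close>

section \<open>Subsequences dominated off disjoint blocks\<close>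

text \<open>Comparison with twice the larger summand covers \<open>s < 1\<close> and
  \<open>s \<ge> 1\<close> at once; the bound serves as a quasi-triangle inequality.\<close>

lemma powr_add_le:
  fixes x y s :: real
  assumes "0 \<le> s" "0 \<le> x" "0 \<le> y"
  shows "(x + y) powr s \<le> 2 powr s * (x powr s + y powr s)"
proof -
  have "(x + y) powr s \<le> (2 * max x y) powr s"
    using assms by (intro powr_mono2) auto
  also have "\<dots> = 2 powr s * max x y powr s"
    using assms by (simp add: powr_mult)
  also have "\<dots> \<le> 2 powr s * (x powr s + y powr s)"
    by (intro mult_left_mono) (auto simp: max_def)
  finally show ?thesis .
qed

text \<open>Cantor's diagonal argument: Bolzano-Weierstrass is applied coordinate by coordinate, and
  the diagonal sequence is eventually a subsequence of every stage.\<close>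

lemma pointwise_convergent_subsequence:
  fixes b :: "nat \<Rightarrow> nat \<Rightarrow> real"
  assumes "\<And>j. bounded (range (\<lambda>n. b n j))"
  obtains r a where "strict_mono r" "\<And>j. (\<lambda>n. b (r n) j) \<longlonglongrightarrow> a j"
proof -
  interpret subseqs "\<lambda>j r. convergent (\<lambda>n. b (r n) j)"
  proof
    fix j and s :: "nat \<Rightarrow> nat" assume "strict_mono s"
    have "bounded (range (\<lambda>n. b (s n) j))"
      using assms[of j] by (rule bounded_subset) auto
    from bounded_imp_convergent_subsequence[OF this]
    show "\<exists>r. strict_mono r \<and> convergent (\<lambda>n. b ((s \<circ> r) n) j)"
      by (auto simp: convergent_def o_def)
  qed
  have "\<exists>L. (\<lambda>n. b (diagseq n) j) \<longlonglongrightarrow> L" for j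
  proof -
    \<comment> \<open>The shift by \<open>Suc j\<close> discards the indices that were chosen before
      coordinate \<open>j\<close> was treated.\<close>
    have "convergent (\<lambda>n. b ((diagseq \<circ> (+) (Suc j)) n) j)"
    proof (rule diagseq_holds)
      fix r s :: "nat \<Rightarrow> nat" and n
      assume "strict_mono r" and "convergent (\<lambda>i. b (s i) n)"
      then show "convergent (\<lambda>i. b ((s \<circ> r) i) n)"
        using LIMSEQ_subseq_LIMSEQ[of "\<lambda>i. b (s i) n"] by (auto simp: convergent_def o_def)
    qed
    then obtain L where "(\<lambda>n. b (diagseq (n + Suc j)) j) \<longlonglongrightarrow> L"
      by (auto simp: convergent_def o_def add.commute)
    then have "(\<lambda>n. b (diagseq n) j) \<longlonglongrightarrow> L"
      by (rule LIMSEQ_offset)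
    then show ?thesis ..
  qed
  then obtain a where "\<And>j. (\<lambda>n. b (diagseq n) j) \<longlonglongrightarrow> a j" by metis
  with subseq_diagseq that show ?thesis by blast
qed

text \<open>A subsequence converges in every coordinate, and its limit has a finite weighted power
  sum because partial sums pass to the limit. Terms are then picked so that each is close to the
  limit below its block and small above it. The errors are summable over the terms, so the limit
  plus one common error function dominates everything off the blocks. The condition
  \<open>0 < J 0\<close> keeps coordinate \<open>0\<close> out of all blocks.\<close>

lemma gliding_hump:
  fixes b :: "nat \<Rightarrow> nat \<Rightarrow> real" and w :: "nat \<Rightarrow> real"
  assumes s: "0 < s" and w: "\<And>j. 0 < w j"
    and b: "\<And>n j. 0 \<le> b n j" "\<And>n j. b n j \<le> 1"
    and summable: "\<And>n. summable (\<lambda>j. w j * b n j powr s)"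
    and C: "\<And>n. (\<Sum>j. w j * b n j powr s) \<le> C"
  obtains r J a where "inj (r :: nat \<Rightarrow> nat)" "strict_mono (J :: nat \<Rightarrow> nat)" "0 < J 0"
    "\<And>j. 0 \<le> a j" "summable (\<lambda>j. w j * a j powr s)"
    "\<And>i j. j \<notin> {J i..<J (Suc i)} \<Longrightarrow> b (r i) j \<le> a j"
proof -
  have "bounded (range (\<lambda>n. b n j))" for j
    by (rule boundedI[where B = 1]) (use b in \<open>auto simp: abs_le_iff intro: order_trans[of _ 0]\<close>)
  then obtain r0 a where r0: "strict_mono r0" and lim: "\<And>j. (\<lambda>n. b (r0 n) j) \<longlonglongrightarrow> a j"
    using pointwise_convergent_subsequence by blast
  have a0: "0 \<le> a j" for j
    using lim[of j] b(1) by (intro LIMSEQ_le_const) auto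
  have sum_le: "(\<Sum>j<m. w j * a j powr s) \<le> C" for m
  proof (rule LIMSEQ_le_const2)
    show "(\<lambda>n. \<Sum>j<m. w j * b (r0 n) j powr s) \<longlonglongrightarrow> (\<Sum>j<m. w j * a j powr s)"
      using s a0 b by (intro tendsto_intros lim tendsto_powr2) (auto intro!: always_eventually)
    have "(\<Sum>j<m. w j * b (r0 n) j powr s) \<le> C" for n
      using sum_le_suminf[OF summable[of "r0 n"], of "{..<m}"] C[of "r0 n"] w
      by (auto simp: less_imp_le order.trans)
    then show "\<exists>N. \<forall>n\<ge>N. (\<Sum>j<m. w j * b (r0 n) j powr s) \<le> C" by blast
  qed
  have suma: "summable (\<lambda>j. w j * a j powr s)"
    by (rule summableI_nonneg_bounded[where x = C]) (use w sum_le in \<open>auto simp: less_imp_le\<close>)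
  define head where "head n m = (\<Sum>j<m. w j * \<bar>b (r0 n) j - a j\<bar> powr s)" for n m
  define tail where "tail n m = (\<Sum>j. w (j + m) * b (r0 n) (j + m) powr s)" for n m
  \<comment> \<open>The order of the choices matters: for the given cut \<open>m\<close> convergence
    in finitely many coordinates yields \<open>n'\<close>, and only then does the convergent series
    of that single term yield \<open>m'\<close>.\<close>
  have step: "\<exists>n' m'. n < n' \<and> m < m' \<and> head n' m < (1/2) ^ i \<and> tail n' m' < (1/2) ^ i"
    for i n m :: nat
  proof -
    have "(\<lambda>n. head n m) \<longlonglongrightarrow> (\<Sum>j<m. w j * \<bar>a j - a j\<bar> powr s)"
      unfolding head_def using s
      by (intro tendsto_intros lim tendsto_powr2) (auto intro!: always_eventually)
    then have "(\<lambda>n. head n m) \<longlonglongrightarrow> 0" by simp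
    then have "\<forall>\<^sub>F n in sequentially. head n m < (1/2) ^ i"
      by (rule order_tendstoD) simp
    then have "\<forall>\<^sub>F k in sequentially. n < k \<and> head k m < (1/2) ^ i"
      using eventually_gt_at_top[of n] by eventually_elim simp
    then obtain n' where n': "n < n'" "head n' m < (1/2) ^ i"
      by (auto simp: eventually_sequentially)
    have "(\<lambda>m. tail n' m) \<longlonglongrightarrow> 0"
      unfolding tail_def by (rule suminf_exist_split2[OF summable])
    then have "\<forall>\<^sub>F m in sequentially. tail n' m < (1/2) ^ i"
      by (rule order_tendstoD) simp
    then have "\<forall>\<^sub>F k in sequentially. m < k \<and> tail n' k < (1/2) ^ i"
      using eventually_gt_at_top[of m] by eventually_elim simp
    then obtain m' where "m < m'" "tail n' m' < (1/2) ^ i"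
      by (auto simp: eventually_sequentially)
    with n' show ?thesis by blast
  qed
  have "\<exists>f. \<forall>i. 0 < snd (f i) \<and>
      (fst (f i) < fst (f (Suc i)) \<and> snd (f i) < snd (f (Suc i)) \<and>
       head (fst (f (Suc i))) (snd (f i)) < (1/2) ^ i \<and>
       tail (fst (f (Suc i))) (snd (f (Suc i))) < (1/2 :: real) ^ i)"
  proof (rule dependent_nat_choice)
    show "\<exists>x :: nat \<times> nat. 0 < snd x"
      by (rule exI[of _ "(0, 1)"]) simp
    fix x :: "nat \<times> nat" and i assume "0 < snd x"
    obtain n' m' where "fst x < n'" "snd x < m'" "head n' (snd x) < (1/2) ^ i" "tail n' m' < (1/2) ^ i"
      using step by blast
    then show "\<exists>y. 0 < snd y \<and> fst x < fst y \<and> snd x < snd y \<and>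
        head (fst y) (snd x) < (1/2) ^ i \<and> tail (fst y) (snd y) < (1/2) ^ i"
      by (intro exI[of _ "(n', m')"]) simp
  qed
  then obtain f :: "nat \<Rightarrow> nat \<times> nat" where
    f: "\<And>i. 0 < snd (f i)" "\<And>i. fst (f i) < fst (f (Suc i))" "\<And>i. snd (f i) < snd (f (Suc i))"
      "\<And>i. head (fst (f (Suc i))) (snd (f i)) < (1/2) ^ i"
      "\<And>i. tail (fst (f (Suc i))) (snd (f (Suc i))) < (1/2) ^ i" by auto
  define J where "J i = snd (f i)" for i
  \<comment> \<open>The index found at stage \<open>Suc i\<close> has its head below
    \<open>J i\<close> and its tail from \<open>J (Suc i)\<close> on under control, so it belongs to
    block \<open>i\<close>; hence the shift.\<close>
  define n where "n i = fst (f (Suc i))" for i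
  define r where "r i = r0 (n i)" for i
  have "strict_mono n" unfolding n_def by (rule strict_monoI_Suc) (rule f)
  with r0 have "inj r"
    unfolding r_def by (metis strict_mono_o strict_mono_imp_inj_on o_def ext)
  have J: "strict_mono J" unfolding J_def by (rule strict_monoI_Suc) (rule f)
  have J0: "0 < J 0" unfolding J_def by (rule f)
  \<comment> \<open>Below the block the error is the distance to the limit; above it the whole entry
    counts as error; inside the block nothing is claimed.\<close>
  define e where "e i j = (if j < J i then \<bar>b (r i) j - a j\<bar>
      else if J (Suc i) \<le> j then b (r i) j else 0)" for i j
  have e0: "0 \<le> e i j" for i j unfolding e_def using b by simp
  have e_sum: "(\<Sum>j<m. w j * e i j powr s) \<le> 2 * (1/2) ^ i" for i m
  proof -
    have sm: "summable (\<lambda>j. w (j + J (Suc i)) * b (r i) (j + J (Suc i)) powr s)"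
      by (rule summable_ignore_initial_segment) (rule summable)
    have "(\<Sum>j<m. w j * e i j powr s) \<le> (\<Sum>j<J (Suc i) + m. w j * e i j powr s)"
      using w by (intro sum_mono2) (auto simp: less_imp_le)
    also have "\<dots> = (\<Sum>j<J (Suc i). w j * e i j powr s)
        + (\<Sum>j<m. w (j + J (Suc i)) * e i (j + J (Suc i)) powr s)"
      using sum.atLeastLessThan_concat[of 0 "J (Suc i)" "J (Suc i) + m" "\<lambda>j. w j * e i j powr s"]
        sum.shift_bounds_nat_ivl[of "\<lambda>j. w j * e i j powr s" 0 "J (Suc i)" m]
      by (simp add: atLeast0LessThan add.commute)
    also have "(\<Sum>j<J (Suc i). w j * e i j powr s) = (\<Sum>j<J i. w j * e i j powr s)"
      using strict_mono_less[OF J, of i "Suc i"] by (intro sum.mono_neutral_right) (auto simp: e_def)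
    also have "\<dots> = head (n i) (J i)"
      by (auto simp: head_def e_def r_def intro!: sum.cong)
    also have "(\<Sum>j<m. w (j + J (Suc i)) * e i (j + J (Suc i)) powr s)
        = (\<Sum>j<m. w (j + J (Suc i)) * b (r i) (j + J (Suc i)) powr s)"
      using strict_mono_less[OF J, of i "Suc i"] by (auto simp: e_def intro!: sum.cong)
    also have "\<dots> \<le> tail (n i) (J (Suc i))"
      unfolding tail_def r_def[symmetric]
      using w by (intro sum_le_suminf sm) (auto simp: less_imp_le)
    finally show ?thesis
      using f(4)[of i] f(5)[of i] by (simp add: n_def J_def)
  qed
  have geo: "summable (\<lambda>i. 2 * (1/2::real) ^ i)" "(\<Sum>i. 2 * (1/2::real) ^ i) = 4"
    using suminf_mult[OF summable_geometric[of "1/2::real"], of 2]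
    by (auto simp: suminf_geometric intro!: summable_mult summable_geometric)
  have e_i: "w j * e i j powr s \<le> 2 * (1/2) ^ i" for i j
  proof -
    have "w j * e i j powr s \<le> (\<Sum>j<Suc j. w j * e i j powr s)"
      using w by (intro member_le_sum) (auto simp: less_imp_le)
    also note e_sum finally show ?thesis .
  qed
  have e_summable: "summable (\<lambda>i. w j * e i j powr s)" for j
    by (rule summable_comparison_test'[OF geo(1), where N = 0])
       (use e_i w in \<open>auto simp: abs_mult less_imp_le\<close>)
  then have e_summable': "summable (\<lambda>i. e i j powr s)" for j
    using w[of j] by (metis summable_cmult_iff less_irrefl)
  \<comment> \<open>The \<open>s\<close>-power sum over \<open>i\<close> dominates every single
    error, and its \<open>s\<close>-th power is additive, so the weighted double series can be
    summed over \<open>j\<close> first, for \<open>s\<close> below and above \<open>1\<close>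
    alike.\<close>
  define E where "E j = (\<Sum>i. e i j powr s) powr (1 / s)" for j
  have E_s: "E j powr s = (\<Sum>i. e i j powr s)" for j
    using s suminf_nonneg[OF e_summable'[of j]] by (simp add: E_def powr_powr)
  have e_E: "e i j \<le> E j" for i j
  proof -
    have "e i j powr s \<le> (\<Sum>i. e i j powr s)"
      using sum_le_suminf[OF e_summable'[of j], of "{i}"] by simp
    then have "(e i j powr s) powr (1 / s) \<le> E j"
      unfolding E_def using s by (intro powr_mono2) auto
    then show ?thesis using s e0 by (simp add: powr_powr)
  qed
  have "(\<Sum>j<m. w j * E j powr s) \<le> 4" for m
  proof -
    have "(\<Sum>j<m. w j * E j powr s) = (\<Sum>j<m. \<Sum>i. w j * e i j powr s)"
      by (simp add: E_s suminf_mult e_summable')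
    also have "\<dots> = (\<Sum>i. \<Sum>j<m. w j * e i j powr s)"
      by (rule suminf_sum[symmetric]) (rule e_summable)
    also have "\<dots> \<le> (\<Sum>i. 2 * (1/2::real) ^ i)"
      by (rule suminf_le[OF e_sum _ geo(1)]) (intro summable_sum e_summable)
    finally show ?thesis by (simp add: geo)
  qed
  then have sumE: "summable (\<lambda>j. w j * E j powr s)"
    by (intro summableI_nonneg_bounded[where x = 4]) (use w in \<open>auto simp: less_imp_le\<close>)
  show ?thesis
  proof (rule that[of r J "\<lambda>j. a j + E j"])
    have E0: "0 \<le> E j" for j by (simp add: E_def)
    with a0 show "0 \<le> a j + E j" for j by simp
    show "summable (\<lambda>j. w j * (a j + E j) powr s)"
    proof (rule summable_comparison_test')
      show "summable (\<lambda>j. 2 powr s * (w j * a j powr s + w j * E j powr s))"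
        by (intro summable_mult summable_add suma sumE)
      fix j :: nat
      show "norm (w j * (a j + E j) powr s) \<le> 2 powr s * (w j * a j powr s + w j * E j powr s)"
        using mult_left_mono[OF powr_add_le[of s "a j" "E j"], of "w j"] w[of j] s a0[of j] E0[of j]
        by (simp add: algebra_simps)
    qed
    fix i j assume "j \<notin> {J i..<J (Suc i)}"
    then have "b (r i) j \<le> a j + e i j"
      using a0[of j] by (auto simp: e_def)
    with e_E[of i j] show "b (r i) j \<le> a j + E j" by linarith
  qed fact+
qed

section \<open>A discrete Hardy inequality\<close>

text \<open>Convolution with a geometric kernel. The ratio \<open>1/4\<close> is that of the squares
  of consecutive dyadic heights, as it occurs in second moments truncated at height
  \<open>2 ^ j\<close>.\<close>

definition hardy :: "(nat \<Rightarrow> real) \<Rightarrow> nat \<Rightarrow> real" where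
  "hardy a j = (\<Sum>i\<le>j. (1/4) ^ (j - i) * a i)"

lemma hardy_nonneg: "(\<And>i. 0 \<le> a i) \<Longrightarrow> 0 \<le> hardy a j"
  unfolding hardy_def by (intro sum_nonneg) simp

lemma hardy_pos: "(\<And>i. 0 \<le> a i) \<Longrightarrow> 0 < a 0 \<Longrightarrow> 0 < hardy a j"
  unfolding hardy_def by (intro sum_pos2[where i = 0]) auto

lemma hardy_mono: "(\<And>i. a i \<le> b i) \<Longrightarrow> hardy a j \<le> hardy b j"
  unfolding hardy_def by (intro sum_mono mult_left_mono) auto

lemma hardy_add: "hardy (\<lambda>i. a i + b i) j = hardy a j + hardy b j"
  by (simp add: hardy_def algebra_simps sum.distrib)

text \<open>
  For some \<open>\<theta> < 1\<close> the kernel \<open>4 powr - m\<close> splits as \<open>4 powr ((\<theta> - 1) * m) * 4 powr (- \<theta> * m)\<close>: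
  the first factor is summed against the supremum of the remaining terms, and the supremum is
  estimated by their \<open>s\<close>-power sum. This treats \<open>s < 1\<close> and \<open>s \<ge> 1\<close> alike.
\<close>

lemma hardy_inequality:
  fixes q s :: real
  assumes "0 < s" and "q < 2 * s"
  obtains C where "0 \<le> C"
    "\<And>a. (\<And>j. 0 \<le> a j) \<Longrightarrow> summable (\<lambda>j. 2 powr (q * j) * a j powr s) \<Longrightarrow>
       summable (\<lambda>j. 2 powr (q * j) * hardy a j powr s) \<and>
       (\<Sum>j. 2 powr (q * j) * hardy a j powr s) \<le> C * (\<Sum>j. 2 powr (q * j) * a j powr s)"
proof -
  \<comment> \<open>The witness is the midpoint of \<open>q / (2 * s)\<close> and \<open>1\<close>.
    Being below \<open>1\<close> gives \<open>x < 1\<close>, being above \<open>q / (2 * s)\<close>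
    gives \<open>\<rho> < 1\<close>.\<close>
  obtain \<theta> where \<theta>: "\<theta> < 1" "q < 2 * \<theta> * s"
  proof (rule that)
    show "(1 + q / (2 * s)) / 2 < 1" "q < 2 * ((1 + q / (2 * s)) / 2) * s"
      using assms by (auto simp: field_simps)
  qed
  define x where "x = (4::real) powr (\<theta> - 1)"
  define y where "y = (4::real) powr (- \<theta>)"
  define \<rho> where "\<rho> = 2 powr q * y powr s"
  have x: "0 < x" "x < 1" and y: "0 < y"
    using \<theta> powr_less_mono[of "\<theta> - 1" 0 4] by (auto simp: x_def y_def)
  have xy: "x * y = 1/4"
    unfolding x_def y_def powr_add[symmetric] by (simp add: powr_minus_divide)
  have "\<rho> = 2 powr q * 2 powr (- 2 * \<theta> * s)"
    using powr_powr[of 2 2 "- \<theta> * s"] unfolding \<rho>_def y_def by (simp add: powr_powr mult.assoc)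
  also have "\<dots> = 2 powr (q - 2 * \<theta> * s)"
    unfolding powr_add[symmetric] by (simp add: algebra_simps)
  also have "\<dots> < 2 powr 0" using \<theta> by (intro powr_less_mono) auto
  finally have \<rho>: "\<rho> < 1" by simp
  have \<rho>0: "0 < \<rho>" using y by (simp add: \<rho>_def)
  define G where "G = 1 / (1 - x)"
  have G: "0 < G" using x by (simp add: G_def)
  have geo: "(\<Sum>i\<le>j. x ^ (j - i)) \<le> G" for j :: nat
  proof -
    have "(\<Sum>i\<le>j. x ^ (j - i)) = (\<Sum>i\<le>j. x ^ i)"
      by (rule sum.reindex_bij_witness[of _ "\<lambda>i. j - i" "\<lambda>i. j - i"]) auto
    also have "\<dots> \<le> (\<Sum>i. x ^ i)"
      using x by (intro sum_le_suminf summable_geometric) auto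
    also have "\<dots> = G" using x by (simp add: suminf_geometric G_def)
    finally show ?thesis .
  qed
  show ?thesis
  proof (rule that[of "G powr s * (1 / (1 - \<rho>))"])
    show "0 \<le> G powr s * (1 / (1 - \<rho>))" using \<rho> by simp
    fix a :: "nat \<Rightarrow> real"
    assume a: "\<And>j. 0 \<le> a j" and sum: "summable (\<lambda>j. 2 powr (q * j) * a j powr s)"
    let ?a = "\<lambda>j. 2 powr (q * real j) * a j powr s"
    \<comment> \<open>This is the Cauchy product of the weighted power sequence with the geometric
      series of ratio \<open>\<rho>\<close>, so its sum factorizes.\<close>
    let ?c = "\<lambda>j. \<Sum>i\<le>j. ?a i * \<rho> ^ (j - i)"
    have sg: "summable (\<lambda>j. norm (\<rho> ^ j))" using \<rho> \<rho>0 by (simp add: summable_geometric)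
    have sn: "summable (\<lambda>j. norm (?a j))" using sum by simp
    have c: "summable ?c" "(\<Sum>j. ?c j) = (\<Sum>j. ?a j) * (1 / (1 - \<rho>))"
      using summable_Cauchy_product[OF sn sg] Cauchy_product[OF sn sg] \<rho> \<rho>0
      by (simp_all add: suminf_geometric)
    have le: "2 powr (q * j) * hardy a j powr s \<le> G powr s * ?c j" for j
    proof -
      define v where "v i = y ^ (j - i) * a i" for i
      have v0: "0 \<le> v i" for i using y a by (simp add: v_def)
      define V where "V = (\<Sum>i\<le>j. v i powr s)"
      have V0: "0 \<le> V" unfolding V_def by (intro sum_nonneg) simp
      have v_le: "v i \<le> V powr (1 / s)" if "i \<le> j" for i
      proof -
        have "v i powr s \<le> V"
          unfolding V_def using that by (intro member_le_sum) auto
        then have "(v i powr s) powr (1 / s) \<le> V powr (1 / s)"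
          using assms by (intro powr_mono2) auto
        then show ?thesis using assms v0 by (simp add: powr_powr)
      qed
      have "hardy a j = (\<Sum>i\<le>j. x ^ (j - i) * v i)"
        unfolding hardy_def v_def by (simp add: xy[symmetric] power_mult_distrib mult.assoc)
      also have "\<dots> \<le> (\<Sum>i\<le>j. x ^ (j - i) * V powr (1 / s))"
        using x v_le by (intro sum_mono mult_left_mono) auto
      also have "\<dots> = (\<Sum>i\<le>j. x ^ (j - i)) * V powr (1 / s)"
        by (simp add: sum_distrib_right)
      also have "\<dots> \<le> G * V powr (1 / s)"
        by (intro mult_right_mono geo) simp
      finally have "hardy a j powr s \<le> (G * V powr (1 / s)) powr s"
        using assms a by (intro powr_mono2 hardy_nonneg) auto
      also have "\<dots> = G powr s * V"
        using G V0 assms by (simp add: powr_mult powr_powr)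
      finally have "2 powr (q * j) * hardy a j powr s \<le> 2 powr (q * j) * (G powr s * V)"
        by (intro mult_left_mono) auto
      also have "\<dots> = G powr s * (\<Sum>i\<le>j. 2 powr (q * j) * v i powr s)"
        by (simp add: V_def sum_distrib_left algebra_simps)
      also have "(\<Sum>i\<le>j. 2 powr (q * j) * v i powr s) = ?c j"
      proof (rule sum.cong)
        fix i assume "i \<in> {..j}"
        then have ij: "real j = real i + real (j - i)" by simp
        have "2 powr (q * j) = 2 powr (q * i) * (2 powr q) ^ (j - i)"
          unfolding ij by (simp add: algebra_simps powr_add powr_realpow[symmetric] powr_powr)
        moreover have "v i powr s = (y powr s) ^ (j - i) * a i powr s"
          using y a unfolding v_def
          by (simp add: powr_mult powr_realpow[symmetric] powr_powr mult.commute)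
        ultimately show "2 powr (q * j) * v i powr s = ?a i * \<rho> ^ (j - i)"
          by (simp add: \<rho>_def power_mult_distrib algebra_simps)
      qed simp
      finally show ?thesis .
    qed
    have sc: "summable (\<lambda>j. G powr s * ?c j)" by (rule summable_mult) (rule c)
    have sh: "summable (\<lambda>j. 2 powr (q * j) * hardy a j powr s)"
      by (rule summable_comparison_test'[OF sc, where N = 0]) (use le in simp)
    have "(\<Sum>j. 2 powr (q * j) * hardy a j powr s) \<le> (\<Sum>j. G powr s * ?c j)"
      by (rule suminf_le[OF le sh sc])
    also have "\<dots> = G powr s * (1 / (1 - \<rho>)) * (\<Sum>j. ?a j)"
      using c by (simp add: suminf_mult)
    finally show "summable (\<lambda>j. 2 powr (q * j) * hardy a j powr s) \<and>
       (\<Sum>j. 2 powr (q * j) * hardy a j powr s) \<le> G powr s * (1 / (1 - \<rho>)) * (\<Sum>j. ?a j)"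
      using sh by blast
  qed
qed

section \<open>Random signs\<close>

text \<open>The sub-Gaussian bound for a fair sign: Hoeffding's lemma with parameters
  \<open>2 * y\<close> and \<open>1/2\<close>, extended to negative arguments by evenness.\<close>

lemma cosh_le_exp_square: "cosh x \<le> exp (x\<^sup>2 / 2)" for x :: real
proof -
  have "cosh y \<le> exp (y\<^sup>2 / 2)" if "0 \<le> y" for y :: real
  proof -
    have "1 + (1/2) * (exp (2 * y) - 1) = exp y * cosh y"
      by (simp add: cosh_def exp_minus field_simps flip: exp_add mult_2)
    with Hoeffdings_lemma_aux[of "2 * y" "1/2"] that
    have "ln (cosh y) \<le> y\<^sup>2 / 2"
      by (simp add: ln_mult power2_eq_square)
    then show ?thesis
      by (metis cosh_real_pos exp_le_cancel_iff exp_ln)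
  qed
  from this[of "\<bar>x\<bar>"] show ?thesis by simp
qed

text \<open>The inequality \<open>u \<le> exp u\<close> at \<open>u = t / s\<close> is raised to the
  power \<open>s\<close>. It lets one exponential moment control the moment of order
  \<open>s\<close>.\<close>

lemma powr_le_exp:
  fixes s t :: real
  assumes "0 < s" "0 \<le> t"
  shows "t powr s \<le> s powr s * exp t"
proof -
  have "t / s \<le> exp (t / s)"
    using exp_ge_add_one_self[of "t / s"] by linarith
  then have "t powr s \<le> (s * exp (t / s)) powr s"
    using assms by (intro powr_mono2) (auto simp: field_simps)
  also have "\<dots> = s powr s * exp t"
    using assms by (simp add: powr_mult exp_powr_real)
  finally show ?thesis .
qed

lemma sum_Pow_insert:
  assumes "finite A" "n \<notin> A"
  shows "(\<Sum>S\<in>Pow (insert n A). g S) = (\<Sum>S\<in>Pow A. g S + g (insert n S))"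
proof -
  have "inj_on (insert n) (Pow A)"
    using assms(2) by (intro inj_onI) (metis PowD insert_ident subsetD)
  moreover have "Pow A \<inter> insert n ` Pow A = {}" using assms by auto
  ultimately show ?thesis
    using assms by (simp add: Pow_insert sum.union_disjoint sum.reindex sum.distrib)
qed

text \<open>\<open>S\<close> is the set of indices with a plus sign, so for finite \<open>A\<close>
  the mean over independent fair signs is the sum over \<open>Pow A\<close> divided by
  \<open>2 ^ card A\<close>.\<close>

definition signed_sum :: "'i set \<Rightarrow> 'i set \<Rightarrow> ('i \<Rightarrow> 'v) \<Rightarrow> 'v::ab_group_add" where
  "signed_sum A S v = (\<Sum>n\<in>A. if n \<in> S then v n else - v n)"

lemma signed_sum_empty [simp]: "signed_sum {} S v = 0"
  by (simp add: signed_sum_def)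

lemma signed_sum_insert:
  assumes "finite A" "n \<notin> A" "S \<subseteq> A"
  shows "signed_sum (insert n A) S v = signed_sum A S v - v n"
    and "signed_sum (insert n A) (insert n S) v = signed_sum A S v + v n"
proof -
  have "(\<Sum>i\<in>A. if i \<in> insert n S then v i else - v i) = signed_sum A S v"
    unfolding signed_sum_def using assms by (intro sum.cong) auto
  then show "signed_sum (insert n A) (insert n S) v = signed_sum A S v + v n"
    using assms by (simp add: signed_sum_def add.commute)
  show "signed_sum (insert n A) S v = signed_sum A S v - v n"
    using assms by (auto simp: signed_sum_def)
qed

lemma norm_signed_sum_le:
  fixes v :: "'i \<Rightarrow> 'v::real_normed_vector"
  shows "norm (signed_sum A S v) \<le> (\<Sum>n\<in>A. norm (v n))"
  unfolding signed_sum_def by (rule order_trans[OF norm_sum]) (auto intro: sum_mono)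

lemma signed_sum_eq_0: "(\<And>n. n \<in> A \<Longrightarrow> v n = 0) \<Longrightarrow> signed_sum A S v = 0"
  by (simp add: signed_sum_def sum.neutral)

lemma signed_sum_cong: "(\<And>n. n \<in> A \<Longrightarrow> v n = v' n) \<Longrightarrow> signed_sum A S v = signed_sum A S v'"
  unfolding signed_sum_def by (intro sum.cong) auto

lemma borel_measurable_signed_sum:
  fixes y :: "'i \<Rightarrow> 'a \<Rightarrow> 'v::euclidean_space"
  assumes "\<And>n. n \<in> A \<Longrightarrow> y n \<in> borel_measurable M"
  shows "(\<lambda>\<omega>. signed_sum A S (\<lambda>n. y n \<omega>)) \<in> borel_measurable M"
  unfolding signed_sum_def using assms by (intro borel_measurable_sum) auto

text \<open>The discriminant criterion behind the Cauchy-Schwarz inequality. For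
  \<open>0 < c\<close> the minimiser \<open>t = - b / c\<close> is inserted; for
  \<open>c = 0\<close> and \<open>b \<noteq> 0\<close> the chosen \<open>t\<close> gives the value
  \<open>-1\<close>.\<close>

lemma sq_le_of_quadratic_nonneg:
  fixes a b c :: real
  assumes "\<And>t. 0 \<le> a + 2 * t * b + t\<^sup>2 * c" and "0 \<le> c"
  shows "b\<^sup>2 \<le> a * c"
proof (cases "c = 0")
  case True
  have "b = 0"
  proof (rule ccontr)
    assume "b \<noteq> 0"
    with assms(1)[of "- (a + 1) / (2 * b)"] True show False by (simp add: field_simps)
  qed
  with True show ?thesis by simp
next
  case False
  with assms(2) have "0 < c" by simp
  with assms(1)[of "- b / c"] show ?thesis
    by (simp add: field_simps power2_eq_square)
qed

context prob_space
begin

lemma integrable_bounded_inner: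
  fixes f g :: "'a \<Rightarrow> 'v::euclidean_space"
  assumes "f \<in> borel_measurable M" "g \<in> borel_measurable M"
    and "\<And>\<omega>. norm (f \<omega>) \<le> c" "\<And>\<omega>. norm (g \<omega>) \<le> d"
  shows "integrable M (\<lambda>\<omega>. f \<omega> \<bullet> g \<omega>)"
proof (rule integrable_const_bound[where B = "c * d"])
  have "norm (f \<omega> \<bullet> g \<omega>) \<le> c * d" for \<omega>
  proof -
    have "0 \<le> c" using assms(3)[of \<omega>] norm_ge_zero order_trans by blast
    then have "norm (f \<omega>) * norm (g \<omega>) \<le> c * d"
      using assms by (intro mult_mono) auto
    then show ?thesis using Cauchy_Schwarz_ineq2[of "f \<omega>" "g \<omega>"] by simp
  qed
  then show "AE \<omega> in M. norm (f \<omega> \<bullet> g \<omega>) \<le> c * d" by simp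
qed (use assms in measurable)

lemma Cauchy_Schwarz_integral_inner:
  fixes f g :: "'a \<Rightarrow> 'v::euclidean_space"
  assumes "f \<in> borel_measurable M" "g \<in> borel_measurable M"
    and "\<And>\<omega>. norm (f \<omega>) \<le> c" "\<And>\<omega>. norm (g \<omega>) \<le> d"
  shows "(\<integral>\<omega>. f \<omega> \<bullet> g \<omega> \<partial>M)\<^sup>2 \<le> (\<integral>\<omega>. f \<omega> \<bullet> f \<omega> \<partial>M) * (\<integral>\<omega>. g \<omega> \<bullet> g \<omega> \<partial>M)"
proof (rule sq_le_of_quadratic_nonneg)
  note int = integrable_bounded_inner[OF assms(1,1,3,3)] integrable_bounded_inner[OF assms(1,2,3,4)]
    integrable_bounded_inner[OF assms(2,2,4,4)]
  show "0 \<le> (\<integral>\<omega>. g \<omega> \<bullet> g \<omega> \<partial>M)" by simp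
  fix t :: real
  have "0 \<le> (\<integral>\<omega>. (f \<omega> + t *\<^sub>R g \<omega>) \<bullet> (f \<omega> + t *\<^sub>R g \<omega>) \<partial>M)" by simp
  also have "\<dots> = (\<integral>\<omega>. f \<omega> \<bullet> f \<omega> + 2 * t * (f \<omega> \<bullet> g \<omega>) + t\<^sup>2 * (g \<omega> \<bullet> g \<omega>) \<partial>M)"
    by (simp add: algebra_simps inner_add_left inner_add_right inner_commute power2_eq_square)
  also have "\<dots> = (\<integral>\<omega>. f \<omega> \<bullet> f \<omega> \<partial>M) + 2 * t * (\<integral>\<omega>. f \<omega> \<bullet> g \<omega> \<partial>M) + t\<^sup>2 * (\<integral>\<omega>. g \<omega> \<bullet> g \<omega> \<partial>M)"
    using int by simp
  finally show "0 \<le> (\<integral>\<omega>. f \<omega> \<bullet> f \<omega> \<partial>M) + 2 * t * (\<integral>\<omega>. f \<omega> \<bullet> g \<omega> \<partial>M) + t\<^sup>2 * (\<integral>\<omega>. g \<omega> \<bullet> g \<omega> \<partial>M)" .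
qed

text \<open>An exponential moment for the squared \<open>L2\<close> norm of a Rademacher sum. In the
  induction the two signs of the new term produce a \<open>cosh\<close> of the cross term
  \<open>B S\<close>; its Gaussian bound and Cauchy-Schwarz turn it into a multiple of
  \<open>Q S\<close>, which is absorbed by lowering \<open>u\<close> to \<open>u - 2 * b\<close>.
  This is why \<open>u\<close> is arbitrary, and over all terms it is lowered by twice the total
  second moment.\<close>

lemma exp_moment_signed_sum:
  fixes y :: "'i \<Rightarrow> 'a \<Rightarrow> 'v::euclidean_space"
  assumes "finite A" and "\<And>n. n \<in> A \<Longrightarrow> y n \<in> borel_measurable M"
    and "\<And>n \<omega>. n \<in> A \<Longrightarrow> norm (y n \<omega>) \<le> c"
    and "2 * (\<Sum>n\<in>A. \<integral>\<omega>. y n \<omega> \<bullet> y n \<omega> \<partial>M) < u"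
  shows "(\<Sum>S\<in>Pow A. exp ((\<integral>\<omega>. signed_sum A S (\<lambda>n. y n \<omega>) \<bullet> signed_sum A S (\<lambda>n. y n \<omega>) \<partial>M) / u))
    \<le> 2 ^ card A * exp ((\<Sum>n\<in>A. \<integral>\<omega>. y n \<omega> \<bullet> y n \<omega> \<partial>M)
        / (u - 2 * (\<Sum>n\<in>A. \<integral>\<omega>. y n \<omega> \<bullet> y n \<omega> \<partial>M)))"
  using assms
proof (induction A arbitrary: u rule: finite_induct)
  case empty
  then show ?case by simp
next
  case (insert n A)
  define F where "F S = (\<lambda>\<omega>. signed_sum A S (\<lambda>n. y n \<omega>))" for S
  define Q where "Q S = (\<integral>\<omega>. F S \<omega> \<bullet> F S \<omega> \<partial>M)" for S
  define B where "B S = (\<integral>\<omega>. F S \<omega> \<bullet> y n \<omega> \<partial>M)" for S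
  define b where "b = (\<integral>\<omega>. y n \<omega> \<bullet> y n \<omega> \<partial>M)"
  define \<sigma> where "\<sigma> = (\<Sum>n\<in>A. \<integral>\<omega>. y n \<omega> \<bullet> y n \<omega> \<partial>M)"
  have b: "0 \<le> b" by (simp add: b_def)
  have \<sigma>: "0 \<le> \<sigma>" by (simp add: \<sigma>_def sum_nonneg)
  have Q: "0 \<le> Q S" for S by (simp add: Q_def)
  have sum: "(\<Sum>n\<in>insert n A. \<integral>\<omega>. y n \<omega> \<bullet> y n \<omega> \<partial>M) = b + \<sigma>"
    using insert by (simp add: b_def \<sigma>_def)
  have u: "2 * (b + \<sigma>) < u" using insert.prems(3) by (simp only: sum)
  have F: "F S \<in> borel_measurable M" for S
    unfolding F_def using insert.prems by (intro borel_measurable_signed_sum) auto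
  have F_le: "norm (F S \<omega>) \<le> card A * c" for S \<omega>
    unfolding F_def
    by (rule order_trans[OF norm_signed_sum_le]) (use insert.prems in \<open>auto intro: sum_bounded_above\<close>)
  note y = insert.prems(1)[of n, simplified] and y_le = insert.prems(2)[of n, simplified]
  note int = integrable_bounded_inner[OF F F F_le F_le] integrable_bounded_inner[OF F y F_le y_le]
    integrable_bounded_inner[OF y y y_le y_le]
  have plus: "(\<integral>\<omega>. (F S \<omega> + y n \<omega>) \<bullet> (F S \<omega> + y n \<omega>) \<partial>M) = Q S + b + 2 * B S" for S
  proof -
    have "(\<integral>\<omega>. (F S \<omega> + y n \<omega>) \<bullet> (F S \<omega> + y n \<omega>) \<partial>M)
        = (\<integral>\<omega>. F S \<omega> \<bullet> F S \<omega> + y n \<omega> \<bullet> y n \<omega> + 2 * (F S \<omega> \<bullet> y n \<omega>) \<partial>M)"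
      by (simp add: algebra_simps inner_add_left inner_add_right inner_commute)
    also have "\<dots> = Q S + b + 2 * B S" using int by (simp add: Q_def b_def B_def)
    finally show ?thesis .
  qed
  have minus: "(\<integral>\<omega>. (F S \<omega> - y n \<omega>) \<bullet> (F S \<omega> - y n \<omega>) \<partial>M) = Q S + b - 2 * B S" for S
  proof -
    have "(\<integral>\<omega>. (F S \<omega> - y n \<omega>) \<bullet> (F S \<omega> - y n \<omega>) \<partial>M)
        = (\<integral>\<omega>. F S \<omega> \<bullet> F S \<omega> + y n \<omega> \<bullet> y n \<omega> - 2 * (F S \<omega> \<bullet> y n \<omega>) \<partial>M)"
      by (simp add: algebra_simps inner_diff_left inner_diff_right inner_commute)
    also have "\<dots> = Q S + b - 2 * B S" using int by (simp add: Q_def b_def B_def)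
    finally show ?thesis .
  qed
  have pair: "exp ((Q S + b - 2 * B S) / u) + exp ((Q S + b + 2 * B S) / u)
      \<le> 2 * exp (b / u) * exp (Q S / (u - 2 * b))" for S
  proof -
    have "(B S)\<^sup>2 \<le> Q S * b"
      unfolding B_def Q_def b_def by (rule Cauchy_Schwarz_integral_inner[OF F y F_le y_le])
    then have "(2 * B S / u)\<^sup>2 / 2 \<le> 2 * (Q S * b) / u\<^sup>2"
      by (simp add: power_divide power_mult_distrib divide_right_mono)
    also have "\<dots> = Q S * (2 * b / u\<^sup>2)" by simp
    \<comment> \<open>The difference of reciprocals is exactly what raises \<open>Q S / u\<close> to
      \<open>Q S / (u - 2 * b)\<close>, the exponent in the induction hypothesis.\<close>
    also have "\<dots> \<le> Q S * (1 / (u - 2 * b) - 1 / u)"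
    proof (rule mult_left_mono[OF _ Q])
      have "2 * b / u\<^sup>2 \<le> 2 * b / (u * (u - 2 * b))"
        using u b \<sigma> by (intro divide_left_mono) (auto simp: power2_eq_square intro!: mult_left_mono mult_pos_pos)
      also have "\<dots> = 1 / (u - 2 * b) - 1 / u"
        using u b \<sigma> by (simp add: field_simps)
      finally show "2 * b / u\<^sup>2 \<le> 1 / (u - 2 * b) - 1 / u" .
    qed
    finally have *: "(Q S + b) / u + (2 * B S / u)\<^sup>2 / 2 \<le> b / u + Q S / (u - 2 * b)"
      by (simp add: algebra_simps add_divide_distrib)
    have "exp ((Q S + b - 2 * B S) / u) + exp ((Q S + b + 2 * B S) / u)
        = 2 * exp ((Q S + b) / u) * cosh (2 * B S / u)"
      by (simp add: cosh_def exp_add[symmetric] distrib_left add_divide_distrib diff_divide_distrib)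
    also have "\<dots> \<le> 2 * exp ((Q S + b) / u) * exp ((2 * B S / u)\<^sup>2 / 2)"
      by (intro mult_left_mono cosh_le_exp_square) auto
    also have "\<dots> = 2 * exp ((Q S + b) / u + (2 * B S / u)\<^sup>2 / 2)"
      by (simp only: exp_add mult.assoc)
    also have "\<dots> \<le> 2 * exp (b / u + Q S / (u - 2 * b))"
      using * by simp
    finally show ?thesis by (simp add: exp_add)
  qed
  have "(\<Sum>S\<in>Pow (insert n A). exp ((\<integral>\<omega>. signed_sum (insert n A) S (\<lambda>n. y n \<omega>)
          \<bullet> signed_sum (insert n A) S (\<lambda>n. y n \<omega>) \<partial>M) / u))
      = (\<Sum>S\<in>Pow A. exp ((Q S + b - 2 * B S) / u) + exp ((Q S + b + 2 * B S) / u))"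
    using insert.hyps
    by (subst sum_Pow_insert) (auto simp: signed_sum_insert plus[unfolded F_def] minus[unfolded F_def] intro!: sum.cong)
  also have "\<dots> \<le> (\<Sum>S\<in>Pow A. 2 * exp (b / u) * exp (Q S / (u - 2 * b)))"
    by (intro sum_mono pair)
  also have "\<dots> = 2 * exp (b / u) * (\<Sum>S\<in>Pow A. exp (Q S / (u - 2 * b)))"
    by (simp add: sum_distrib_left)
  also have "\<dots> \<le> 2 * exp (b / u) * (2 ^ card A * exp (\<sigma> / (u - 2 * b - 2 * \<sigma>)))"
    using insert.IH[of "u - 2 * b"] insert.prems u
    by (intro mult_left_mono) (auto simp: Q_def F_def \<sigma>_def)
  also have "\<dots> = 2 ^ card (insert n A) * exp (b / u + \<sigma> / (u - 2 * b - 2 * \<sigma>))"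
    using insert.hyps by (simp add: exp_add)
  also have "\<dots> \<le> 2 ^ card (insert n A) * exp ((b + \<sigma>) / (u - 2 * (b + \<sigma>)))"
  proof -
    have "b / u \<le> b / (u - 2 * (b + \<sigma>))"
      using u b \<sigma> by (intro divide_left_mono) auto
    then show ?thesis by (simp add: add_divide_distrib algebra_simps)
  qed
  finally show ?case by (simp only: sum)
qed

end

section \<open>Distribution functions of signed sums\<close>

text \<open>
  On a probability space the values of a function below \<open>1\<close> do not matter for these estimates;
  the entry \<open>1\<close> at \<open>j = 0\<close> stands for them and absorbs additive constants.
\<close>

definition level :: "'a measure \<Rightarrow> ('a \<Rightarrow> 'v::real_normed_vector) \<Rightarrow> nat \<Rightarrow> real" where
  "level M f j = (if j = 0 then 1 else measure M {\<omega> \<in> space M. 2 ^ j < norm (f \<omega>)})"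

text \<open>For \<open>z\<close> in \<open>[0, 1]\<close> one has \<open>z \<le> z powr s\<close>;
  this is applied to the shares of \<open>x\<close> and \<open>y\<close> in
  \<open>x + y\<close>.\<close>

lemma powr_subadditive:
  fixes x y s :: real
  assumes "0 \<le> s" "s \<le> 1" "0 \<le> x" "0 \<le> y"
  shows "(x + y) powr s \<le> x powr s + y powr s"
proof (cases "x + y = 0")
  case False
  with assms have xy: "0 < x + y" by simp
  have *: "z * (x + y) powr s \<le> (z * (x + y)) powr s" if "0 \<le> z" "z \<le> 1" for z
  proof -
    have "z \<le> z powr s" using powr_mono'[of s 1 z] that assms by simp
    then show ?thesis using that xy by (simp add: powr_mult mult_right_mono)
  qed
  have "(x + y) powr s = x / (x + y) * (x + y) powr s + y / (x + y) * (x + y) powr s"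
    using xy by (simp flip: distrib_right add_divide_distrib)
  also have "\<dots> \<le> (x / (x + y) * (x + y)) powr s + (y / (x + y) * (x + y)) powr s"
    using assms xy by (intro add_mono *) auto
  finally show ?thesis using xy by simp
qed (use assms in auto)

context prob_space
begin

lemma level_bounds: "0 \<le> level M f j" "level M f j \<le> 1"
  by (auto simp: level_def)

lemma measurable_superlevel:
  fixes f :: "'a \<Rightarrow> 'v::euclidean_space"
  assumes "f \<in> borel_measurable M"
  shows "{\<omega> \<in> space M. r < norm (f \<omega>)} \<in> sets M"
  using assms by measurable

text \<open>
  Chebyshev's inequality is applied to the truncations at height \<open>l\<close>; what they leave out
  is estimated by the union bound.
\<close>

lemma exp_superlevel_signed_sum:
  fixes x :: "'i \<Rightarrow> 'a \<Rightarrow> 'v::euclidean_space"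
  assumes "finite A" and meas: "\<And>n. n \<in> A \<Longrightarrow> x n \<in> borel_measurable M" and l: "0 < l" and h: "0 < h"
    and le: "(\<Sum>n\<in>A. prob {\<omega> \<in> space M. l < norm (x n \<omega>)} +
        (\<integral>\<omega>. (if norm (x n \<omega>) \<le> l then (norm (x n \<omega>))\<^sup>2 else 0) \<partial>M) / l\<^sup>2) \<le> h"
  shows "(\<Sum>S\<in>Pow A. exp (prob {\<omega> \<in> space M. l < norm (signed_sum A S (\<lambda>n. x n \<omega>))} / (4 * h)))
    \<le> 2 ^ card A * exp 1"
proof -
  define y where "y n \<omega> = (if norm (x n \<omega>) \<le> l then x n \<omega> else 0)" for n \<omega>
  have ym: "y n \<in> borel_measurable M" if "n \<in> A" for n
    unfolding y_def using meas[OF that] by measurable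
  have yl: "norm (y n \<omega>) \<le> l" for n \<omega> using l by (auto simp: y_def)
  have yy: "(\<integral>\<omega>. y n \<omega> \<bullet> y n \<omega> \<partial>M)
      = (\<integral>\<omega>. (if norm (x n \<omega>) \<le> l then (norm (x n \<omega>))\<^sup>2 else 0) \<partial>M)" for n
    by (intro Bochner_Integration.integral_cong) (auto simp: y_def power2_norm_eq_inner)
  define \<alpha> where "\<alpha> = (\<Sum>n\<in>A. prob {\<omega> \<in> space M. l < norm (x n \<omega>)})"
  define \<sigma> where "\<sigma> = (\<Sum>n\<in>A. \<integral>\<omega>. y n \<omega> \<bullet> y n \<omega> \<partial>M)"
  have \<alpha>0: "0 \<le> \<alpha>" and \<sigma>0: "0 \<le> \<sigma>" by (simp_all add: \<alpha>_def \<sigma>_def sum_nonneg)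
  have \<alpha>\<sigma>: "\<alpha> + \<sigma> / l\<^sup>2 \<le> h"
    using le by (simp add: \<alpha>_def \<sigma>_def yy sum.distrib sum_divide_distrib)
  define F where "F S = (\<lambda>\<omega>. signed_sum A S (\<lambda>n. y n \<omega>))" for S
  define Q where "Q S = (\<integral>\<omega>. F S \<omega> \<bullet> F S \<omega> \<partial>M)" for S
  have F: "F S \<in> borel_measurable M" for S
    unfolding F_def using ym by (intro borel_measurable_signed_sum) auto
  have F_le: "norm (F S \<omega>) \<le> card A * l" for S \<omega>
    unfolding F_def
    by (rule order_trans[OF norm_signed_sum_le]) (use yl in \<open>auto intro: sum_bounded_above\<close>)
  have Z: "prob {\<omega> \<in> space M. l < norm (signed_sum A S (\<lambda>n. x n \<omega>))} \<le> \<alpha> + Q S / l\<^sup>2" for S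
  proof -
    define T where "T = (\<Union>n\<in>A. {\<omega> \<in> space M. l < norm (x n \<omega>)})"
    define U where "U = {\<omega> \<in> space M. l\<^sup>2 \<le> F S \<omega> \<bullet> F S \<omega>}"
    have T: "T \<in> events"
      unfolding T_def using \<open>finite A\<close> measurable_superlevel[OF meas] by (intro sets.finite_UN) auto
    have U: "U \<in> events" unfolding U_def using F[of S] by measurable
    have "prob {\<omega> \<in> space M. l < norm (signed_sum A S (\<lambda>n. x n \<omega>))} \<le> prob (T \<union> U)"
    proof (rule finite_measure_mono)
      show "{\<omega> \<in> space M. l < norm (signed_sum A S (\<lambda>n. x n \<omega>))} \<subseteq> T \<union> U"
      proof
        fix \<omega> assume *: "\<omega> \<in> {\<omega> \<in> space M. l < norm (signed_sum A S (\<lambda>n. x n \<omega>))}"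
        show "\<omega> \<in> T \<union> U"
        proof (cases "\<omega> \<in> T")
          case False
          with * have "x n \<omega> = y n \<omega>" if "n \<in> A" for n
            using that by (auto simp: T_def y_def)
          then have "signed_sum A S (\<lambda>n. x n \<omega>) = F S \<omega>"
            unfolding F_def by (rule signed_sum_cong)
          with * l have "l\<^sup>2 \<le> (norm (F S \<omega>))\<^sup>2"
            by (intro power_mono) auto
          with * show ?thesis by (simp add: U_def power2_norm_eq_inner)
        qed simp
      qed
    qed (use T U in simp)
    also have "\<dots> \<le> prob T + prob U" using T U by (rule measure_Un_le)
    also have "prob T \<le> \<alpha>"
      unfolding T_def \<alpha>_def using \<open>finite A\<close> measurable_superlevel[OF meas]
      by (intro finite_measure_subadditive_finite) auto
    also have "prob U \<le> Q S / l\<^sup>2"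
      unfolding U_def Q_def
      by (rule integral_Markov_inequality_measure[OF integrable_bounded_inner[OF F F F_le F_le]])
         (use l in auto)
    finally show ?thesis by simp
  qed
  \<comment> \<open>With \<open>\<sigma> \<le> h * l\<^sup>2\<close> the factor \<open>4\<close>
    makes \<open>\<sigma> / (u - 2 * \<sigma>)\<close> at most \<open>1/2\<close>. The union bound
    part contributes another \<open>1/2\<close> at most, which gives \<open>exp 1\<close> in the
    end.\<close>
  define u where "u = 4 * h * l\<^sup>2"
  have \<sigma>h: "\<sigma> \<le> h * l\<^sup>2"
  proof -
    have "\<sigma> / l\<^sup>2 \<le> h" using \<alpha>\<sigma> \<alpha>0 by linarith
    then show ?thesis using l by (simp add: field_simps)
  qed
  have hl: "0 < h * l\<^sup>2" using h l by simp
  have u: "2 * \<sigma> < u" using \<sigma>h hl by (simp add: u_def)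
  have "\<sigma> / (u - 2 * \<sigma>) \<le> 1 / 2"
    using \<sigma>h u by (simp add: field_simps u_def)
  have "(\<Sum>S\<in>Pow A. exp (prob {\<omega> \<in> space M. l < norm (signed_sum A S (\<lambda>n. x n \<omega>))} / (4 * h)))
      \<le> (\<Sum>S\<in>Pow A. exp (1/2) * exp (Q S / u))"
  proof (rule sum_mono)
    fix S
    have "prob {\<omega> \<in> space M. l < norm (signed_sum A S (\<lambda>n. x n \<omega>))} / (4 * h) \<le> (\<alpha> + Q S / l\<^sup>2) / (4 * h)"
      using Z h by (intro divide_right_mono) auto
    also have "\<dots> = \<alpha> / (4 * h) + Q S / u"
      using h l by (simp add: u_def field_simps)
    also have "\<alpha> / (4 * h) \<le> 1/2"
    proof -
      have "0 \<le> \<sigma> / l\<^sup>2" using \<sigma>0 by simp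
      then have "\<alpha> \<le> h" using \<alpha>\<sigma> by linarith
      then show ?thesis using h by simp
    qed
    finally show "exp (prob {\<omega> \<in> space M. l < norm (signed_sum A S (\<lambda>n. x n \<omega>))} / (4 * h))
        \<le> exp (1/2) * exp (Q S / u)"
      by (simp add: exp_add[symmetric])
  qed
  also have "\<dots> = exp (1/2) * (\<Sum>S\<in>Pow A. exp (Q S / u))"
    by (simp add: sum_distrib_left)
  also have "\<dots> \<le> exp (1/2) * (2 ^ card A * exp (\<sigma> / (u - 2 * \<sigma>)))"
    using exp_moment_signed_sum[OF \<open>finite A\<close> ym yl u[unfolded \<sigma>_def]]
    by (intro mult_left_mono) (auto simp: Q_def F_def \<sigma>_def)
  also have "\<dots> \<le> exp (1/2) * (2 ^ card A * exp (1/2))"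
    using \<open>\<sigma> / (u - 2 * \<sigma>) \<le> 1 / 2\<close> by simp
  also have "\<dots> = 2 ^ card A * (exp (1/2) * exp (1/2))" by (simp only: mult_ac)
  also have "\<dots> = 2 ^ card A * exp 1" by (simp add: exp_add[symmetric])
  finally show ?thesis .
qed

text \<open>The estimate holds pointwise before integration. If \<open>2 ^ i\<close> is the least
  dyadic height above the norm, the normalized square is at most \<open>(1/4) ^ (j - i)\<close>, and
  the norm exceeds \<open>2 ^ (i - 1)\<close>; the shift from \<open>i\<close> to
  \<open>i - 1\<close> costs the factor \<open>4\<close>. Norms above \<open>2 ^ j\<close> are
  covered by the summand at \<open>j\<close>. The layer \<open>E 0\<close> is the whole space, in
  accordance with the value of \<open>level\<close> at \<open>0\<close>.\<close>

lemma truncated_square_le_hardy: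
  fixes f :: "'a \<Rightarrow> 'v::euclidean_space"
  assumes f: "f \<in> borel_measurable M"
  shows "prob {\<omega> \<in> space M. 2 ^ j < norm (f \<omega>)} +
      (\<integral>\<omega>. (if norm (f \<omega>) \<le> 2 ^ j then (norm (f \<omega>))\<^sup>2 else 0) \<partial>M) / (2 ^ j)\<^sup>2
    \<le> 4 * hardy (level M f) j"
proof -
  define E where "E i = (if i = 0 then space M else {\<omega> \<in> space M. 2 ^ i < norm (f \<omega>)})" for i :: nat
  have E: "E i \<in> events" for i
    unfolding E_def using measurable_superlevel[OF f] by simp
  have level: "level M f i = (\<integral>\<omega>. indicator (E i) \<omega> \<partial>M)" for i
    using E[of i] by (simp add: level_def E_def prob_space)
  let ?g = "\<lambda>\<omega>. if norm (f \<omega>) \<le> 2 ^ j then (norm (f \<omega>))\<^sup>2 else (0::real)"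
  let ?k = "\<lambda>\<omega>. indicator {\<omega> \<in> space M. 2 ^ j < norm (f \<omega>)} \<omega> :: real"
  have le: "?k \<omega> + ?g \<omega> / (2 ^ j)\<^sup>2 \<le> (\<Sum>i\<le>j. 4 * (1/4) ^ (j - i) * indicator (E i) \<omega>)"
    if "\<omega> \<in> space M" for \<omega>
  proof -
    have ge: "4 * (1/4) ^ (j - i) \<le> (\<Sum>i\<le>j. 4 * (1/4) ^ (j - i) * (indicator (E i) \<omega> :: real))"
      if "i \<le> j" "\<omega> \<in> E i" for i
    proof -
      have "4 * (1/4) ^ (j - i) * (indicator (E i) \<omega> :: real)
          \<le> (\<Sum>i\<le>j. 4 * (1/4) ^ (j - i) * (indicator (E i) \<omega> :: real))"
        using that by (intro member_le_sum) auto
      with that show ?thesis by simp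
    qed
    show ?thesis
    proof (cases "norm (f \<omega>) \<le> 2 ^ j")
      case False
      then have "\<omega> \<in> E j" using that by (auto simp: E_def)
      from ge[OF _ this] False that show ?thesis by simp
    next
      case True
      define i where "i = (LEAST i. norm (f \<omega>) \<le> 2 ^ i)"
      have i: "norm (f \<omega>) \<le> 2 ^ i" unfolding i_def using True by (rule LeastI)
      have ij: "i \<le> j" unfolding i_def using True by (rule Least_le)
      have "(norm (f \<omega>))\<^sup>2 / (2 ^ j)\<^sup>2 \<le> (2 ^ i)\<^sup>2 / (2 ^ j)\<^sup>2"
        using i by (intro divide_right_mono power_mono) auto
      also have "\<dots> = (1/4) ^ (j - i)"
      proof -
        have "(2 ^ k)\<^sup>2 = (4::real) ^ k" for k :: nat
          by (simp add: power2_eq_square flip: power_mult_distrib)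
        moreover have "(4::real) ^ j = 4 ^ i * 4 ^ (j - i)"
          using ij by (simp flip: power_add)
        ultimately show ?thesis by (simp add: power_divide)
      qed
      \<comment> \<open>Natural subtraction sends \<open>i = 0\<close> to layer \<open>0\<close>
        again; there the factor \<open>4\<close> is mere slack.\<close>
      also have "\<dots> \<le> 4 * (1/4) ^ (j - (i - 1))"
        by (cases "i = 0") (use ij in \<open>auto simp: Suc_diff_le simp flip: diff_Suc_eq_diff_pred\<close>)
      also have "\<omega> \<in> E (i - 1)"
      proof (cases "i - 1 = 0")
        case True then show ?thesis using that by (simp add: E_def)
      next
        case False
        then have "\<not> norm (f \<omega>) \<le> 2 ^ (i - 1)"
          using not_less_Least[of "i - 1" "\<lambda>i. norm (f \<omega>) \<le> 2 ^ i"] by (auto simp: i_def)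
        with False that show ?thesis by (simp add: E_def)
      qed
      then have "4 * (1/4) ^ (j - (i - 1)) \<le> (\<Sum>i\<le>j. 4 * (1/4) ^ (j - i) * (indicator (E i) \<omega> :: real))"
        using ij by (intro ge) auto
      finally show ?thesis using True by simp
    qed
  qed
  have ig: "integrable M ?g"
    by (rule integrable_const_bound[where B = "(2 ^ j)\<^sup>2"])
       (use f in \<open>auto intro!: power_mono\<close>)
  have ik: "integrable M ?k"
    using measurable_superlevel[OF f, of "2 ^ j"]
    by (intro integrable_real_indicator) (simp_all add: emeasure_eq_measure)
  have "prob {\<omega> \<in> space M. 2 ^ j < norm (f \<omega>)} + (\<integral>\<omega>. ?g \<omega> \<partial>M) / (2 ^ j)\<^sup>2
      = (\<integral>\<omega>. ?k \<omega> + ?g \<omega> / (2 ^ j)\<^sup>2 \<partial>M)"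
    using ig ik measurable_superlevel[OF f] by simp
  also have "\<dots> \<le> (\<integral>\<omega>. (\<Sum>i\<le>j. 4 * (1/4) ^ (j - i) * indicator (E i) \<omega>) \<partial>M)"
  proof (rule integral_mono)
    show "integrable M (\<lambda>\<omega>. ?k \<omega> + ?g \<omega> / (2 ^ j)\<^sup>2)"
      by (intro Bochner_Integration.integrable_add ik integrable_divide ig)
    show "integrable M (\<lambda>\<omega>. \<Sum>i\<le>j. 4 * (1/4) ^ (j - i) * indicator (E i) \<omega> :: real)"
      using E by (intro Bochner_Integration.integrable_sum integrable_mult_right integrable_real_indicator)
        (simp_all add: emeasure_eq_measure)
  qed (rule le)
  also have "\<dots> = 4 * hardy (level M f) j"
  proof (subst Bochner_Integration.integral_sum)
    show "integrable M (\<lambda>\<omega>. 4 * (1/4) ^ (j - i) * indicator (E i) \<omega> :: real)" for i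
      using E by (intro integrable_mult_right integrable_real_indicator) (simp_all add: emeasure_eq_measure)
    show "(\<Sum>i\<le>j. \<integral>\<omega>. 4 * (1/4) ^ (j - i) * indicator (E i) \<omega> \<partial>M) = 4 * hardy (level M f) j"
      by (simp add: level hardy_def sum_distrib_left mult.assoc del: integral_indicator)
  qed
  finally show ?thesis .
qed

text \<open>For \<open>h < 1\<close> the exponential moment of the probability divided by
  \<open>4 * h\<close> bounds its \<open>s\<close>-th power; for \<open>1 \<le> h\<close>
  probabilities are at most \<open>1\<close>. The cap \<open>min 1 h\<close> later keeps each fixed
  level bounded as the number of summands grows.\<close>

lemma sum_superlevel_powr_le:
  fixes x :: "'i \<Rightarrow> 'a \<Rightarrow> 'v::euclidean_space"
  assumes "finite A" and meas: "\<And>n. n \<in> A \<Longrightarrow> x n \<in> borel_measurable M" and s: "0 < s"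
    and h: "0 < h" "(\<Sum>n\<in>A. 4 * hardy (level M (x n)) j) \<le> h"
  shows "(\<Sum>S\<in>Pow A. prob {\<omega> \<in> space M. 2 ^ j < norm (signed_sum A S (\<lambda>n. x n \<omega>))} powr s)
    \<le> max 1 ((4 * s) powr s * exp 1) * 2 ^ card A * min 1 h powr s"
proof (cases "1 \<le> h")
  case True
  have "(\<Sum>S\<in>Pow A. prob {\<omega> \<in> space M. 2 ^ j < norm (signed_sum A S (\<lambda>n. x n \<omega>))} powr s)
      \<le> (\<Sum>S\<in>Pow A. 1)"
    using s by (intro sum_mono powr_le1) auto
  also have "\<dots> = 1 * 2 ^ card A" by (simp add: card_Pow \<open>finite A\<close>)
  also have "\<dots> \<le> max 1 ((4 * s) powr s * exp 1) * 2 ^ card A"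
    by (intro mult_right_mono) auto
  finally show ?thesis using True by simp
next
  case False
  let ?Z = "\<lambda>S. prob {\<omega> \<in> space M. 2 ^ j < norm (signed_sum A S (\<lambda>n. x n \<omega>))}"
  have "?Z S powr s \<le> (4 * s) powr s * h powr s * exp (?Z S / (4 * h))" for S
  proof -
    have "?Z S powr s = (4 * h) powr s * (?Z S / (4 * h)) powr s"
      using h by (simp add: powr_divide)
    also have "\<dots> \<le> (4 * h) powr s * (s powr s * exp (?Z S / (4 * h)))"
      using s h by (intro mult_left_mono powr_le_exp) auto
    finally show ?thesis using s h by (simp add: powr_mult mult_ac)
  qed
  then have "(\<Sum>S\<in>Pow A. ?Z S powr s) \<le> (\<Sum>S\<in>Pow A. (4 * s) powr s * h powr s * exp (?Z S / (4 * h)))"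
    by (intro sum_mono)
  also have "\<dots> = (4 * s) powr s * h powr s * (\<Sum>S\<in>Pow A. exp (?Z S / (4 * h)))"
    by (simp add: sum_distrib_left)
  also have "\<dots> \<le> (4 * s) powr s * h powr s * (2 ^ card A * exp 1)"
  proof (intro mult_left_mono exp_superlevel_signed_sum)
    show "(\<Sum>n\<in>A. prob {\<omega> \<in> space M. 2 ^ j < norm (x n \<omega>)} +
        (\<integral>\<omega>. (if norm (x n \<omega>) \<le> 2 ^ j then (norm (x n \<omega>))\<^sup>2 else 0) \<partial>M) / (2 ^ j)\<^sup>2) \<le> h"
      by (rule order_trans[OF sum_mono h(2)]) (intro truncated_square_le_hardy meas)
  qed (use h assms in auto)
  also have "\<dots> = ((4 * s) powr s * exp 1) * 2 ^ card A * h powr s" by simp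
  also have "\<dots> \<le> max 1 ((4 * s) powr s * exp 1) * 2 ^ card A * h powr s"
    by (intro mult_right_mono) auto
  finally show ?thesis using False by simp
qed

text \<open>A single term cannot be hidden by cancellation: \<open>2 * x n\<close> is the difference
  of the sums with the two signs of \<open>x n\<close>, so one of them exceeds \<open>l\<close> in
  norm wherever \<open>x n\<close> does. Subadditivity of the \<open>s\<close>-th power, valid as
  \<open>s \<le> 1\<close>, separates the two events.\<close>

lemma sum_superlevel_powr_ge:
  fixes x :: "'i \<Rightarrow> 'a \<Rightarrow> 'v::euclidean_space"
  assumes "finite A" and meas: "\<And>n. n \<in> A \<Longrightarrow> x n \<in> borel_measurable M"
    and s: "0 < s" "s \<le> 1" and n: "n \<in> A"
  shows "2 ^ card A * prob {\<omega> \<in> space M. l < norm (x n \<omega>)} powr s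
    \<le> 2 * (\<Sum>S\<in>Pow A. prob {\<omega> \<in> space M. l < norm (signed_sum A S (\<lambda>n. x n \<omega>))} powr s)"
proof -
  define B where "B = A - {n}"
  have A: "A = insert n B" "n \<notin> B" "finite B" using n assms by (auto simp: B_def)
  define F where "F S = (\<lambda>\<omega>. signed_sum B S (\<lambda>n. x n \<omega>))" for S
  have F: "F S \<in> borel_measurable M" for S
    unfolding F_def using meas A by (intro borel_measurable_signed_sum) auto
  note xn = meas[OF n]
  let ?p = "prob {\<omega> \<in> space M. l < norm (x n \<omega>)}"
  have pair: "?p powr s \<le> prob {\<omega> \<in> space M. l < norm (F S \<omega> - x n \<omega>)} powr s
      + prob {\<omega> \<in> space M. l < norm (F S \<omega> + x n \<omega>)} powr s" (is "_ \<le> ?a powr s + ?b powr s") for S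
  proof -
    have "?p \<le> prob ({\<omega> \<in> space M. l < norm (F S \<omega> - x n \<omega>)} \<union> {\<omega> \<in> space M. l < norm (F S \<omega> + x n \<omega>)})"
    proof (rule finite_measure_mono)
      have "2 * norm (x n \<omega>) \<le> norm (F S \<omega> + x n \<omega>) + norm (F S \<omega> - x n \<omega>)" for \<omega>
      proof -
        have "norm (2 *\<^sub>R x n \<omega>) = norm ((F S \<omega> + x n \<omega>) - (F S \<omega> - x n \<omega>))"
          by (simp add: scaleR_2)
        also have "\<dots> \<le> norm (F S \<omega> + x n \<omega>) + norm (F S \<omega> - x n \<omega>)" by (rule norm_triangle_ineq4)
        finally show ?thesis by simp
      qed
      then show "{\<omega> \<in> space M. l < norm (x n \<omega>)}
          \<subseteq> {\<omega> \<in> space M. l < norm (F S \<omega> - x n \<omega>)} \<union> {\<omega> \<in> space M. l < norm (F S \<omega> + x n \<omega>)}"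
        by (auto simp: not_less) (smt (verit, best))
    qed (use F[of S] xn in measurable)
    also have "\<dots> \<le> ?a + ?b"
      by (rule measure_Un_le) (use F[of S] xn in measurable)
    finally have "?p powr s \<le> (?a + ?b) powr s" using s by (intro powr_mono2) auto
    also have "\<dots> \<le> ?a powr s + ?b powr s" using s by (intro powr_subadditive) auto
    finally show ?thesis .
  qed
  have "2 ^ card B * ?p powr s = (\<Sum>S\<in>Pow B. ?p powr s)"
    using A by (simp add: card_Pow)
  also have "\<dots> \<le> (\<Sum>S\<in>Pow B. prob {\<omega> \<in> space M. l < norm (F S \<omega> - x n \<omega>)} powr s
      + prob {\<omega> \<in> space M. l < norm (F S \<omega> + x n \<omega>)} powr s)"
    by (intro sum_mono pair)
  also have "\<dots> = (\<Sum>S\<in>Pow A. prob {\<omega> \<in> space M. l < norm (signed_sum A S (\<lambda>n. x n \<omega>))} powr s)"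
    unfolding A(1) using A(2,3)
    by (subst sum_Pow_insert) (auto simp: signed_sum_insert F_def intro!: sum.cong)
  finally show ?thesis using A by simp
qed

end

section \<open>Signed sums on a probability space\<close>

context prob_space
begin

text \<open>The contradiction in a form free of Lorentz spaces: the dyadic sum represents the
  \<open>q\<close>-th power of the norm. Empty \<open>A\<close> is excluded because level
  \<open>0\<close> alone contributes \<open>1\<close>, whereas \<open>card A powr s\<close> would be
  \<open>0\<close>.\<close>

lemma no_power_type_signed_sums:
  fixes x :: "nat \<Rightarrow> 'a \<Rightarrow> 'v::euclidean_space" and s q c C :: real
  assumes meas: "\<And>n. x n \<in> borel_measurable M" and s: "0 < s" "s \<noteq> 1" and q: "q < 2 * s" and c: "0 < c"
    and summ: "\<And>A S. finite A \<Longrightarrow> A \<noteq> {} \<Longrightarrow> S \<subseteq> A \<Longrightarrow>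
      summable (\<lambda>j. 2 powr (q * j) * level M (\<lambda>\<omega>. signed_sum A S (\<lambda>n. x n \<omega>)) j powr s)"
    and upper: "\<And>A S. finite A \<Longrightarrow> A \<noteq> {} \<Longrightarrow> S \<subseteq> A \<Longrightarrow>
      (\<Sum>j. 2 powr (q * j) * level M (\<lambda>\<omega>. signed_sum A S (\<lambda>n. x n \<omega>)) j powr s) \<le> C * card A powr s"
    and lower: "\<And>A S. finite A \<Longrightarrow> A \<noteq> {} \<Longrightarrow> S \<subseteq> A \<Longrightarrow>
      c * card A powr s \<le> (\<Sum>j. 2 powr (q * j) * level M (\<lambda>\<omega>. signed_sum A S (\<lambda>n. x n \<omega>)) j powr s)"
  shows False
proof -

  \<comment> \<open>The gliding hump subsequence and its blocks\<close>
  define w where "w j = 2 powr (q * real j)" for j :: nat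
  have w: "0 < w j" for j by (simp add: w_def)
  define b where "b n = level M (x n)" for n
  have single: "signed_sum {n} {n} (\<lambda>n. x n \<omega>) = x n \<omega>" for n \<omega> by (simp add: signed_sum_def)
  have b: "0 \<le> b n j" "b n j \<le> 1" for n j by (simp_all add: b_def level_bounds)
  have b_sum: "summable (\<lambda>j. w j * b n j powr s)" for n
    using summ[of "{n}" "{n}"] by (simp add: single w_def b_def)
  have b_le: "(\<Sum>j. w j * b n j powr s) \<le> C" for n
    using upper[of "{n}" "{n}"] by (simp add: single w_def b_def)
  have C: "0 \<le> C"
    using suminf_nonneg[OF b_sum[of 0]] b_le[of 0] w by (simp add: less_imp_le order.trans)
  obtain r J a where r: "inj r" and J: "strict_mono J" "0 < J 0"
    and a: "\<And>j. 0 \<le> a j" "summable (\<lambda>j. w j * a j powr s)"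
    and ab: "\<And>i j. j \<notin> {J i..<J (Suc i)} \<Longrightarrow> b (r i) j \<le> a j"
  proof (rule gliding_hump[of s w b C, OF s(1) w b b_sum b_le], goal_cases)
    case (1 r J a)
    show ?case by (rule 1(1)) (fact 1)+
  qed
  \<comment> \<open>Level \<open>0\<close> lies outside the blocks, so the dominating sequence
    inherits the conventional entry \<open>1\<close>; this makes its Hardy transform strictly
    positive.\<close>
  have "0 \<notin> {J 0..<J (Suc 0)}" using J(2) by simp
  from ab[OF this] have a_0: "1 \<le> a 0" by (simp add: b_def level_def)
  define block where "block i = {J i..<J (Suc i)}" for i
  have block_disj: "block i \<inter> block i' = {}" if "i \<noteq> i'" for i i'
  proof -
    have "block i \<inter> block i' = {}" if "i < i'" for i i'
      using that strict_mono_leD[OF J(1), of "Suc i" i'] by (auto simp: block_def)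
    with that show ?thesis by (metis Int_commute linorder_neqE_nat)
  qed
  have block_pos: "0 < j" if "j \<in> block i" for i j
    using that J(2) strict_mono_leD[OF J(1), of 0 i] by (simp add: block_def)
  define N where "N i = (\<Sum>j\<in>block i. w j * b (r i) j powr s)" for i
  have N0: "0 \<le> N i" for i unfolding N_def using w by (intro sum_nonneg) (simp add: less_imp_le)
  have NC: "N i \<le> C" for i
    using sum_le_suminf[OF b_sum[of "r i"], of "block i"] b_le[of "r i"] w
    by (simp add: N_def block_def less_imp_le)
  define f where "f I S = (\<lambda>\<omega>. signed_sum (r ` I) S (\<lambda>n. x n \<omega>))" for I S
  have card_r: "card (r ` I) = card I" for I
    using r by (simp add: card_image inj_on_subset)
  have f_sum: "summable (\<lambda>j. w j * level M (f I S) j powr s)"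
    and f_upper: "(\<Sum>j. w j * level M (f I S) j powr s) \<le> C * card I powr s"
    and f_lower: "c * card I powr s \<le> (\<Sum>j. w j * level M (f I S) j powr s)"
    if "finite I" "I \<noteq> {}" "S \<in> Pow (r ` I)" for I S
    using summ[of "r ` I" S] upper[of "r ` I" S] lower[of "r ` I" S] that
    by (simp_all add: w_def f_def card_r)

  \<comment> \<open>Index sets of size \<open>k\<close> with block mass of smaller order than
    \<open>k powr s\<close>\<close>
  obtain B \<sigma> where B: "0 \<le> B" and \<sigma>: "\<sigma> < s"
    and I_ex: "\<And>k. \<exists>I. finite I \<and> card I = k \<and> sum N I \<le> B * k powr \<sigma>"
  proof (cases "1 < s")
    case True
    have "\<exists>I. finite I \<and> card I = k \<and> sum N I \<le> C * k powr 1" for k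
      using sum_bounded_above[of "{..<k}" N C] NC by (intro exI[of _ "{..<k}"]) (simp add: mult.commute)
    with that[OF C True] show ?thesis .
  next
    case False
    with s have s1: "s < 1" by simp
    \<comment> \<open>On its block each entry is controlled by twice the mean over the signs. Blocks
      being disjoint, the masses add up inside the dyadic sum of one signed sum, whose upper bound
      they inherit.\<close>
    have le: "sum N I \<le> 2 * C * card I powr s" if I: "finite I" "I \<noteq> {}" for I
    proof -
      let ?P = "Pow (r ` I)"
      have cP: "card ?P = 2 ^ card I" using I by (simp add: card_Pow card_r)
      have blk: "2 ^ card I * N i \<le> 2 * (\<Sum>S\<in>?P. \<Sum>j\<in>block i. w j * level M (f I S) j powr s)"
        if "i \<in> I" for i
      proof -
        have "2 ^ card I * N i = (\<Sum>j\<in>block i. w j * (2 ^ card I * b (r i) j powr s))"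
          by (simp add: N_def sum_distrib_left mult_ac)
        also have "\<dots> \<le> (\<Sum>j\<in>block i. w j * (2 * (\<Sum>S\<in>?P. level M (f I S) j powr s)))"
        proof (intro sum_mono mult_left_mono)
          fix j assume "j \<in> block i"
          then have "0 < j" by (rule block_pos)
          then show "2 ^ card I * b (r i) j powr s \<le> 2 * (\<Sum>S\<in>?P. level M (f I S) j powr s)"
            using sum_superlevel_powr_ge[of "r ` I" x s "r i" "2 ^ j"] I s s1 meas that
            by (simp add: b_def level_def f_def card_r)
        qed (use w in \<open>simp add: less_imp_le\<close>)
        also have "\<dots> = 2 * (\<Sum>j\<in>block i. \<Sum>S\<in>?P. w j * level M (f I S) j powr s)"
          by (simp add: sum_distrib_left mult_ac)
        also have "\<dots> = 2 * (\<Sum>S\<in>?P. \<Sum>j\<in>block i. w j * level M (f I S) j powr s)"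
          by (subst sum.swap) simp
        finally show ?thesis .
      qed
      have "2 ^ card I * sum N I = (\<Sum>i\<in>I. 2 ^ card I * N i)" by (simp add: sum_distrib_left)
      also have "\<dots> \<le> (\<Sum>i\<in>I. 2 * (\<Sum>S\<in>?P. \<Sum>j\<in>block i. w j * level M (f I S) j powr s))"
        by (intro sum_mono blk)
      also have "\<dots> = 2 * (\<Sum>S\<in>?P. \<Sum>i\<in>I. \<Sum>j\<in>block i. w j * level M (f I S) j powr s)"
        by (subst sum.swap[of _ I]) (simp add: sum_distrib_left)
      also have "\<dots> \<le> 2 * (\<Sum>S\<in>?P. C * card I powr s)"
      proof (intro mult_left_mono sum_mono)
        fix S assume S: "S \<in> ?P"
        have "(\<Sum>i\<in>I. \<Sum>j\<in>block i. w j * level M (f I S) j powr s)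
            = (\<Sum>j\<in>(\<Union>i\<in>I. block i). w j * level M (f I S) j powr s)"
          using I block_disj by (intro sum.UNION_disjoint[symmetric]) (auto simp: block_def)
        also have "\<dots> \<le> (\<Sum>j. w j * level M (f I S) j powr s)"
          using I w by (intro sum_le_suminf f_sum S) (auto simp: block_def less_imp_le)
        also have "\<dots> \<le> C * card I powr s" by (rule f_upper[OF I S])
        finally show "(\<Sum>i\<in>I. \<Sum>j\<in>block i. w j * level M (f I S) j powr s) \<le> C * card I powr s" .
      qed simp
      also have "\<dots> = 2 ^ card I * (2 * C * card I powr s)" by (simp add: cP)
      finally show ?thesis by (simp only: mult_le_cancel_left_pos zero_less_power zero_less_numeral)
    qed
    \<comment> \<open>Otherwise \<open>k\<close> blocks of mass at least \<open>\<epsilon>\<close>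
      would exist for every \<open>k\<close>, and \<open>k * \<epsilon>\<close> outgrows
      \<open>2 * C * k powr s\<close> for \<open>s < 1\<close>.\<close>
    have fin: "finite {i. \<epsilon> \<le> N i}" if \<epsilon>: "0 < \<epsilon>" for \<epsilon>
    proof (rule ccontr)
      assume inf: "infinite {i. \<epsilon> \<le> N i}"
      have bd: "1 \<le> 2 * C / \<epsilon> * k powr (s - 1)" if "0 < k" for k :: nat
      proof -
        from inf obtain I where I: "I \<subseteq> {i. \<epsilon> \<le> N i}" "finite I" "card I = k"
          using infinite_arbitrarily_large by blast
        then have "k * \<epsilon> \<le> sum N I" using sum_bounded_below[of I \<epsilon> N] by auto
        also have "\<dots> \<le> 2 * C * k powr s" using le[of I] I that by (cases "I = {}") auto
        finally show ?thesis using that \<epsilon> by (simp add: powr_diff field_simps)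
      qed
      have "((\<lambda>k. 2 * C / \<epsilon> * real k powr (s - 1)) \<longlongrightarrow> 2 * C / \<epsilon> * 0) sequentially"
        using s1 by (intro tendsto_intros tendsto_neg_powr filterlim_real_sequentially) simp
      then have "\<forall>\<^sub>F k in sequentially. 2 * C / \<epsilon> * real k powr (s - 1) < 1"
        by (intro order_tendstoD(2)) auto
      moreover have "\<forall>\<^sub>F k :: nat in sequentially. 0 < k" by (rule eventually_gt_at_top)
      ultimately have "\<forall>\<^sub>F k :: nat in sequentially. False"
      proof eventually_elim
        case (elim k)
        then show ?case using bd[of k] by linarith
      qed
      then show False by simp
    qed
    \<comment> \<open>All but finitely many masses are below \<open>1 / (k + 1)\<close>, so
      \<open>k\<close> of them sum to at most \<open>1\<close>. The case \<open>k = 0\<close> is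
      separate because \<open>0 powr 0 = 0\<close>.\<close>
    have "\<exists>I. finite I \<and> card I = k \<and> sum N I \<le> 1 * k powr 0" for k
    proof -
      have "infinite {i. N i < 1 / (k + 1)}"
      proof
        assume "finite {i. N i < 1 / (k + 1)}"
        with fin[of "1 / (k + 1)"] have "finite ({i. N i < 1 / (k + 1)} \<union> {i. 1 / (k + 1) \<le> N i})" by simp
        also have "{i. N i < 1 / (k + 1)} \<union> {i. 1 / (k + 1) \<le> N i} = UNIV" by auto
        finally show False by simp
      qed
      then obtain I where I: "I \<subseteq> {i. N i < 1 / (k + 1)}" "finite I" "card I = k"
        using infinite_arbitrarily_large by blast
      have "sum N I \<le> card I * (1 / (k + 1))"
        using I by (intro sum_bounded_above) (auto intro: less_imp_le)
      also have "\<dots> \<le> 1 * k powr 0" using I by (cases "k = 0") auto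
      finally show ?thesis using I by blast
    qed
    with that[of 1 0] s show ?thesis by simp
  qed

  \<comment> \<open>The averaged estimate over all signs\<close>
  obtain H where H: "0 \<le> H"
    and hardy: "\<And>a. (\<And>j. 0 \<le> a j) \<Longrightarrow> summable (\<lambda>j. w j * a j powr s) \<Longrightarrow>
       summable (\<lambda>j. w j * hardy a j powr s) \<and>
       (\<Sum>j. w j * hardy a j powr s) \<le> H * (\<Sum>j. w j * a j powr s)"
  proof (rule hardy_inequality[OF s(1) q], goal_cases)
    case (1 H)
    show ?case by (rule 1(1)) (fact 1[folded w_def])+
  qed
  define g where "g = hardy a"
  have g: "summable (\<lambda>j. w j * g j powr s)" "0 < g j" for j
    using hardy[OF a] hardy_pos[of a] a a_0 by (auto simp: g_def)
  \<comment> \<open>The contribution of the dominated parts: \<open>k\<close> terms below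
    \<open>a\<close> have Hardy transforms of total at most \<open>k * g\<close>, capped as
    probabilities are.\<close>
  define \<Theta> where "\<Theta> k = (\<Sum>j. w j * min 1 (4 * real k * g j) powr s)" for k :: nat
  have \<Theta>_sum: "summable (\<lambda>j. w j * min 1 (4 * real k * g j) powr s)" for k
  proof (rule summable_comparison_test')
    show "summable (\<lambda>j. (4 * real k) powr s * (w j * g j powr s))" by (intro summable_mult g)
    fix j :: nat
    have "min 1 (4 * real k * g j) powr s \<le> (4 * real k * g j) powr s"
      using s g(2)[of j] by (intro powr_mono2) auto
    then show "norm (w j * min 1 (4 * real k * g j) powr s) \<le> (4 * real k) powr s * (w j * g j powr s)"
      using w[of j] g(2)[of j] by (simp add: powr_mult mult_ac less_imp_le)
  qed
  \<comment> \<open>The first factor comes from the averaged level estimate, the second from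
    separating the dominated part and the block part inside the \<open>s\<close>-th power.\<close>
  define K where "K = max 1 ((4 * s) powr s * exp 1) * 2 powr s"
  have K: "0 < K" by (simp add: K_def)
  have main: "c * k powr s \<le> K * (\<Theta> k + 4 powr s * H * B * k powr \<sigma>)" if k: "0 < k" for k :: nat
  proof -
    obtain I where I: "finite I" "card I = k" "sum N I \<le> B * k powr \<sigma>" using I_ex by blast
    with k have I0: "I \<noteq> {}" by auto
    let ?P = "Pow (r ` I)"
    have cP: "card ?P = 2 ^ k" using I by (simp add: card_Pow card_r)
    \<comment> \<open>Each term is cut to its own block. At every level at most one cut term is
      nonzero, so the weighted power sum of \<open>V\<close> is just the sum of the block masses,
      for every \<open>s\<close>.\<close>
    define v where "v i j = (if j \<in> block i then b (r i) j else 0)" for i j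
    define V where "V j = (\<Sum>i\<in>I. v i j)" for j
    have v0: "0 \<le> v i j" for i j using b by (simp add: v_def)
    have V0: "0 \<le> V j" for j unfolding V_def by (intro sum_nonneg v0)
    have V_block: "V j = b (r i) j" if "i \<in> I" "j \<in> block i" for i j
    proof -
      have "v i' j = 0" if "i' \<in> I - {i}" for i'
        using that \<open>j \<in> block i\<close> block_disj[of i i'] by (auto simp: v_def)
      then show ?thesis
        using that I by (simp add: V_def sum.remove[of I i] sum.neutral v_def)
    qed
    define U where "U = (\<Union>i\<in>I. block i)"
    have U: "finite U" using I by (simp add: U_def block_def)
    have V_out: "V j = 0" if "j \<notin> U" for j
      using that unfolding V_def v_def U_def by (intro sum.neutral) auto
    have V_sums: "(\<lambda>j. w j * V j powr s) sums (\<Sum>j\<in>U. w j * V j powr s)"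
      using U V_out s by (intro sums_finite) auto
    have "(\<Sum>j\<in>U. w j * V j powr s) = (\<Sum>i\<in>I. \<Sum>j\<in>block i. w j * V j powr s)"
      unfolding U_def using I block_disj by (intro sum.UNION_disjoint) (auto simp: block_def)
    also have "\<dots> = sum N I"
      unfolding N_def using V_block by (intro sum.cong) auto
    finally have V_suminf: "(\<Sum>j. w j * V j powr s) = sum N I" using V_sums by (simp add: sums_iff)
    have hV: "summable (\<lambda>j. w j * hardy V j powr s)" "(\<Sum>j. w j * hardy V j powr s) \<le> H * sum N I"
      using hardy[of V, OF V0] V_sums V_suminf by (auto simp: sums_iff)
    have hV0: "0 \<le> hardy V j" for j by (intro hardy_nonneg V0)
    define h where "h j = 4 * real k * g j + 4 * hardy V j" for j
    have h0: "0 < h j" for j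
      using g(2)[of j] hV0[of j] k by (simp add: h_def add_pos_nonneg)
    have h_le: "(\<Sum>n\<in>r ` I. 4 * hardy (level M (x n)) j) \<le> h j" for j
    proof -
      have "(\<Sum>n\<in>r ` I. 4 * hardy (level M (x n)) j) = (\<Sum>i\<in>I. 4 * hardy (b (r i)) j)"
        using inj_on_subset[OF r subset_UNIV, of I] by (simp add: sum.reindex b_def)
      also have "\<dots> \<le> (\<Sum>i\<in>I. 4 * hardy (\<lambda>j. a j + v i j) j)"
        using ab a(1) by (intro sum_mono mult_left_mono hardy_mono) (auto simp: v_def block_def)
      also have "\<dots> = 4 * real k * g j + 4 * (\<Sum>i\<in>I. hardy (v i) j)"
        using I by (simp add: hardy_add sum.distrib g_def sum_distrib_left distrib_left)
      also have "(\<Sum>i\<in>I. hardy (v i) j) = hardy V j"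
        unfolding hardy_def V_def by (subst sum.swap) (simp add: sum_distrib_left)
      finally show ?thesis by (simp add: h_def)
    qed
    have avg: "(\<Sum>S\<in>?P. level M (f I S) j powr s)
        \<le> 2 ^ k * (K * (min 1 (4 * real k * g j) powr s + (4 * hardy V j) powr s))" for j
    proof -
      \<comment> \<open>The cap is kept on the dominated part only; the block part is summed by the
        Hardy inequality for \<open>V\<close>.\<close>
      have min_le: "min 1 (h j) powr s \<le> 2 powr s * (min 1 (4 * real k * g j) powr s + (4 * hardy V j) powr s)"
      proof -
        have "min 1 (h j) powr s \<le> (min 1 (4 * real k * g j) + 4 * hardy V j) powr s"
          using s h0[of j] hV0[of j] by (intro powr_mono2) (auto simp: h_def min_def)
        also have "\<dots> \<le> 2 powr s * (min 1 (4 * real k * g j) powr s + (4 * hardy V j) powr s)"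
          using s hV0[of j] g(2)[of j] by (intro powr_add_le) auto
        finally show ?thesis .
      qed
      have "(\<Sum>S\<in>?P. level M (f I S) j powr s)
          \<le> max 1 ((4 * s) powr s * exp 1) * 2 ^ k * min 1 (h j) powr s"
      proof (cases "j = 0")
        case True
        \<comment> \<open>At level \<open>0\<close> the entry is \<open>1\<close> by convention, not
          a superlevel probability; the bound holds because \<open>1 \<le> h 0\<close> makes the cap
          equal to \<open>1\<close>.\<close>
        have "hardy (level M (x n)) 0 = 1" for n by (simp add: hardy_def level_def)
        then have "4 * real k \<le> h 0" using h_le[of 0] by (simp add: card_r I)
        with k have "1 \<le> h 0" by linarith
        have "1 * 2 ^ k \<le> max 1 ((4 * s) powr s * exp 1) * 2 ^ k"
          by (intro mult_right_mono) auto
        then show ?thesis using True \<open>1 \<le> h 0\<close> by (simp add: level_def cP)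
      next
        case False
        then show ?thesis
          using sum_superlevel_powr_le[of "r ` I" x s "h j" j] I s meas h0 h_le
          by (simp add: level_def f_def card_r)
      qed
      also have "\<dots> \<le> max 1 ((4 * s) powr s * exp 1) * 2 ^ k *
          (2 powr s * (min 1 (4 * real k * g j) powr s + (4 * hardy V j) powr s))"
        by (intro mult_left_mono min_le) simp
      finally show ?thesis by (simp add: K_def mult_ac)
    qed
    have sum_rhs: "summable (\<lambda>j. w j * min 1 (4 * real k * g j) powr s + 4 powr s * (w j * hardy V j powr s))"
      by (intro summable_add summable_mult \<Theta>_sum hV)
    have "2 ^ k * (c * k powr s) = (\<Sum>S\<in>?P. c * k powr s)" by (simp add: cP)
    also have "\<dots> \<le> (\<Sum>S\<in>?P. \<Sum>j. w j * level M (f I S) j powr s)"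
      using f_lower[OF I(1) I0] I by (intro sum_mono) simp
    also have "\<dots> = (\<Sum>j. \<Sum>S\<in>?P. w j * level M (f I S) j powr s)"
      using f_sum[OF I(1) I0] by (intro suminf_sum[symmetric])
    also have "\<dots> \<le> (\<Sum>j. 2 ^ k * K * (w j * min 1 (4 * real k * g j) powr s + 4 powr s * (w j * hardy V j powr s)))"
    proof (rule suminf_le)
      show "summable (\<lambda>j. \<Sum>S\<in>?P. w j * level M (f I S) j powr s)"
        using f_sum[OF I(1) I0] by (intro summable_sum)
      show "summable (\<lambda>j. 2 ^ k * K * (w j * min 1 (4 * real k * g j) powr s + 4 powr s * (w j * hardy V j powr s)))"
        by (intro summable_mult sum_rhs)
      fix j
      show "(\<Sum>S\<in>?P. w j * level M (f I S) j powr s)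
          \<le> 2 ^ k * K * (w j * min 1 (4 * real k * g j) powr s + 4 powr s * (w j * hardy V j powr s))"
        using mult_left_mono[OF avg[of j], of "w j"] w[of j] hV0[of j]
        by (simp add: sum_distrib_left[symmetric] powr_mult algebra_simps)
    qed
    also have "\<dots> = 2 ^ k * (K * (\<Theta> k + 4 powr s * (\<Sum>j. w j * hardy V j powr s)))"
      using \<Theta>_sum[of k] hV by (simp add: suminf_mult sum_rhs suminf_add[symmetric] summable_mult \<Theta>_def)
    finally have "c * k powr s \<le> K * (\<Theta> k + 4 powr s * (\<Sum>j. w j * hardy V j powr s))"
      by (simp only: mult_le_cancel_left_pos zero_less_power zero_less_numeral)
    also have "\<dots> \<le> K * (\<Theta> k + 4 powr s * (H * (B * k powr \<sigma>)))"
      using K H I(3) hV(2) by (intro mult_left_mono add_left_mono) (auto intro: order_trans mult_left_mono)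
    finally show ?thesis by (simp add: mult_ac)
  qed

  \<comment> \<open>Comparison of growth rates in \<open>k\<close>\<close>
  define \<eta> where "\<eta> = c / (2 * K)"
  have \<eta>: "0 < \<eta>" using c K by (simp add: \<eta>_def)
  obtain m where m: "4 powr s * (\<Sum>j. w (j + m) * g (j + m) powr s) < \<eta>"
  proof -
    have "(\<lambda>m. 4 powr s * (\<Sum>j. w (j + m) * g (j + m) powr s)) \<longlonglongrightarrow> 4 powr s * 0"
      by (intro tendsto_intros suminf_exist_split2 g)
    then have "\<forall>\<^sub>F m in sequentially. 4 powr s * (\<Sum>j. w (j + m) * g (j + m) powr s) < \<eta>"
      using \<eta> by (intro order_tendstoD(2)[where y = "4 powr s * 0"]) auto
    with that show ?thesis by (auto simp: eventually_sequentially)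
  qed
  define R where "R = (\<Sum>j<m. w j)"
  \<comment> \<open>Beyond level \<open>m\<close> the cap is dropped, and the small tail of the
    series for \<open>g\<close> gives \<open>\<eta> * k powr s\<close>; below \<open>m\<close> the
    cap gives a constant free of \<open>k\<close>. As \<open>K * \<eta> = c / 2\<close>, half of the
    lower bound survives.\<close>
  have \<Theta>_le: "\<Theta> k \<le> \<eta> * k powr s + R" for k
  proof -
    have ig: "summable (\<lambda>j. w (j + m) * g (j + m) powr s)"
      using g(1) by (rule summable_ignore_initial_segment)
    have "\<Theta> k = (\<Sum>j. w (j + m) * min 1 (4 * real k * g (j + m)) powr s)
        + (\<Sum>j<m. w j * min 1 (4 * real k * g j) powr s)"
      unfolding \<Theta>_def by (rule suminf_split_initial_segment[OF \<Theta>_sum])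
    also have "(\<Sum>j<m. w j * min 1 (4 * real k * g j) powr s) \<le> R"
      unfolding R_def
    proof (rule sum_mono)
      fix j :: nat
      have "min 1 (4 * real k * g j) powr s \<le> 1" using s g(2)[of j] by (intro powr_le1) auto
      then show "w j * min 1 (4 * real k * g j) powr s \<le> w j" using w[of j] by simp
    qed
    also have "(\<Sum>j. w (j + m) * min 1 (4 * real k * g (j + m)) powr s)
        \<le> (\<Sum>j. k powr s * 4 powr s * (w (j + m) * g (j + m) powr s))"
    proof (rule suminf_le)
      show "summable (\<lambda>j. w (j + m) * min 1 (4 * real k * g (j + m)) powr s)"
        using \<Theta>_sum by (rule summable_ignore_initial_segment)
      show "summable (\<lambda>j. k powr s * 4 powr s * (w (j + m) * g (j + m) powr s))"
        using ig by (rule summable_mult)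
      fix j
      have "min 1 (4 * real k * g (j + m)) powr s \<le> (4 * real k * g (j + m)) powr s"
        using s g(2)[of "j + m"] by (intro powr_mono2) auto
      then show "w (j + m) * min 1 (4 * real k * g (j + m)) powr s
          \<le> k powr s * 4 powr s * (w (j + m) * g (j + m) powr s)"
        using w[of "j + m"] g(2)[of "j + m"] by (simp add: powr_mult mult_ac less_imp_le)
    qed
    also have "\<dots> = k powr s * (4 powr s * (\<Sum>j. w (j + m) * g (j + m) powr s))"
      using ig by (simp add: suminf_mult)
    also have "\<dots> \<le> k powr s * \<eta>" using m by (intro mult_left_mono) auto
    finally show ?thesis by (simp add: mult.commute)
  qed
  define D where "D = 4 powr s * H * B"
  have bound: "c / 2 * k powr s \<le> K * R + K * D * k powr \<sigma>" if "0 < k" for k :: nat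
  proof -
    have "c * k powr s \<le> K * (\<Theta> k + D * k powr \<sigma>)" using main[OF that] by (simp add: D_def)
    also have "\<dots> \<le> K * (\<eta> * k powr s + R + D * k powr \<sigma>)"
      using \<Theta>_le K by (intro mult_left_mono) auto
    also have "\<dots> = c / 2 * k powr s + K * R + K * D * k powr \<sigma>"
      using K by (simp add: \<eta>_def algebra_simps)
    finally show ?thesis by simp
  qed
  \<comment> \<open>After division by \<open>k powr s\<close> both exponents are negative, by
    \<open>0 < s\<close> and \<open>\<sigma> < s\<close>.\<close>
  have "((\<lambda>k. K * R * real k powr (- s) + K * D * real k powr (\<sigma> - s)) \<longlongrightarrow> K * R * 0 + K * D * 0) sequentially"
    using s \<sigma> by (intro tendsto_intros tendsto_neg_powr filterlim_real_sequentially) auto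
  then have "\<forall>\<^sub>F k in sequentially. K * R * real k powr (- s) + K * D * real k powr (\<sigma> - s) < c / 2"
    using c by (intro order_tendstoD(2)) auto
  moreover have "\<forall>\<^sub>F k :: nat in sequentially. 0 < k" by (rule eventually_gt_at_top)
  ultimately have "\<forall>\<^sub>F k :: nat in sequentially. False"
  proof eventually_elim
    case (elim k)
    then have "(K * R * real k powr (- s) + K * D * real k powr (\<sigma> - s)) * k powr s < c / 2 * k powr s"
      by (intro mult_strict_right_mono) auto
    also have "(K * R * real k powr (- s) + K * D * real k powr (\<sigma> - s)) * k powr s
        = K * R + K * D * k powr \<sigma>"
      using elim by (simp add: distrib_right mult.assoc flip: powr_add)
    finally show ?case using bound[of k] elim by simp
  qed
  then show False by simp
qed

end

section \<open>Lorentz norms and dyadic levels\<close>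

lemma ennreal_powr_ennreal: "0 \<le> x \<Longrightarrow> ennreal_powr (ennreal x) a = ennreal (x powr a)"
  by (simp add: ennreal_powr_def)

definition lorentz_integrand ::
  "real \<Rightarrow> real \<Rightarrow> real set \<Rightarrow> (real \<Rightarrow> 'k::real_normed_vector) \<Rightarrow> real \<Rightarrow> ennreal" where
  "lorentz_integrand p q I f t =
     ennreal_powr (ennreal (t powr (1 / p)) * rearrangement I f t) q * ennreal (1 / t)"

lemma lorentz_integrand_finite:
  assumes "0 < p" "0 < q" "0 < t" "rearrangement I f t = ennreal r" "0 \<le> r"
  shows "lorentz_integrand p q I f t = ennreal (t powr (q / p - 1) * r powr q)"
proof -
  have "lorentz_integrand p q I f t = ennreal ((t powr (1 / p) * r) powr q) * ennreal (1 / t)"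
    unfolding lorentz_integrand_def assms(4)
    using assms by (simp add: ennreal_mult'[symmetric] ennreal_powr_ennreal)
  also have "\<dots> = ennreal ((t powr (1 / p) * r) powr q * (1 / t))"
    using assms by (intro ennreal_mult[symmetric]) auto
  also have "(t powr (1 / p) * r) powr q * (1 / t) = t powr (q / p - 1) * r powr q"
    using assms by (simp add: powr_mult powr_powr powr_diff)
  finally show ?thesis .
qed

lemma lorentz_integrand_top:
  assumes "0 < t" "rearrangement I f t = top"
  shows "lorentz_integrand p q I f t = top"
  using assms by (simp add: lorentz_integrand_def ennreal_mult_top ennreal_powr_def ennreal_top_mult)

lemma nn_integral_powr_interval:
  assumes "0 < s" "0 \<le> d"
  shows "(\<integral>\<^sup>+t. ennreal (t powr (s - 1)) * indicator {0<..<d} t \<partial>lborel) = ennreal (d powr s / s)"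
proof -
  have "(\<integral>\<^sup>+t. ennreal (t powr (s - 1)) * indicator {0<..<d} t \<partial>lborel)
      = (\<integral>\<^sup>+t. ennreal (indicator {0..d} t * t powr (s - 1)) \<partial>lborel)"
  proof (rule nn_integral_cong_AE)
    have "AE t in lborel. t \<noteq> (0::real) \<and> t \<noteq> d"
      by (intro AE_conjI AE_lborel_singleton)
    then show "AE t in lborel. ennreal (t powr (s - 1)) * indicator {0<..<d} t
        = ennreal (indicator {0..d} t * t powr (s - 1))"
      by eventually_elim (auto simp: indicator_def)
  qed
  also have "\<dots> = ennreal (d powr s / s)"
    using has_integral_powr_from_0[of "s - 1" d] assms
    by (intro nn_integral_has_integral_lebesgue) auto
  finally show ?thesis .
qed

lemma lorentz_norm_eq:
  "lorentz_norm p q I f = ennreal_powr (\<integral>\<^sup>+t\<in>{0<..}. lorentz_integrand p q I f t \<partial>lborel) (1 / q)"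
  by (simp add: lorentz_norm_def lorentz_integrand_def)

lemma lorentz_integral_finite:
  assumes "0 < q" "lorentz_norm p q I f < top"
  shows "(\<integral>\<^sup>+t\<in>{0<..}. lorentz_integrand p q I f t \<partial>lborel) = ennreal (enn2real (lorentz_norm p q I f) powr q)"
proof (cases "\<integral>\<^sup>+t\<in>{0<..}. lorentz_integrand p q I f t \<partial>lborel")
  case (real x)
  then have "lorentz_norm p q I f = ennreal (x powr (1 / q))"
    by (simp add: lorentz_norm_eq ennreal_powr_ennreal)
  with real assms show ?thesis by (simp add: powr_powr)
next
  case top
  with assms show ?thesis by (simp add: lorentz_norm_eq ennreal_powr_def)
qed

interpretation unit: prob_space "lebesgue_on {0<..<1::real}"
  by (rule prob_spaceI) (simp add: emeasure_restrict_space)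

abbreviation unit_level :: "(real \<Rightarrow> 'v::real_normed_vector) \<Rightarrow> nat \<Rightarrow> real" where
  "unit_level \<equiv> level (lebesgue_on {0<..<1})"

lemma emeasure_unit:
  "emeasure (lebesgue_on {0<..<1}) {x \<in> {0<..<1::real}. l < norm (f x)}
    = ennreal (unit.prob {x \<in> space (lebesgue_on {0<..<1}). l < norm (f x)})"
  by (simp add: unit.emeasure_eq_measure)

lemma rearrangement_unit_ge:
  fixes f :: "real \<Rightarrow> 'v::euclidean_space"
  assumes f: "f \<in> borel_measurable (lebesgue_on {0<..<1})" and j: "0 < j" and t: "0 \<le> t" "t < unit_level f j"
  shows "ennreal (2 ^ j) \<le> rearrangement {0<..<1} f t"
  unfolding rearrangement_def
proof (rule Inf_greatest, clarify)
  fix l :: real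
  assume l: "0 < l" "emeasure (lebesgue_on {0<..<1}) {x \<in> {0<..<1}. l < norm (f x)} \<le> ennreal t"
  have "2 ^ j \<le> l"
  proof (rule ccontr)
    assume "\<not> 2 ^ j \<le> l"
    then have "unit_level f j \<le> unit.prob {x \<in> space (lebesgue_on {0<..<1}). l < norm (f x)}"
      unfolding level_def using j unit.measurable_superlevel[OF f]
      by (auto intro!: unit.finite_measure_mono simp del: space_lebesgue_on)
    also have "\<dots> \<le> t" using l t unfolding emeasure_unit by simp
    finally show False using t by simp
  qed
  then show "ennreal (2 ^ j) \<le> ennreal l" by (rule ennreal_leI)
qed

lemma rearrangement_unit_eq_0:
  assumes "1 \<le> t"
  shows "rearrangement {0<..<1} f t = 0"
proof -
  have le: "rearrangement {0<..<1} f t \<le> ennreal l" if "0 < l" for l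
    unfolding rearrangement_def
  proof (rule Inf_lower, intro CollectI exI[of _ l] conjI refl that)
    have "unit.prob {x \<in> space (lebesgue_on {0<..<1}). l < norm (f x)} \<le> t"
      using unit.prob_le_1 assms by (rule order_trans)
    then show "emeasure (lebesgue_on {0<..<1}) {x \<in> {0<..<1}. l < norm (f x)} \<le> ennreal t"
      unfolding emeasure_unit by (rule ennreal_leI)
  qed
  have "rearrangement {0<..<1} f t \<le> 0"
  proof (rule ennreal_le_epsilon)
    fix e :: real assume "0 < e"
    with le[of e] show "rearrangement {0<..<1} f t \<le> 0 + ennreal e" by simp
  qed
  then show ?thesis by simp
qed

lemma rearrangement_unit_le:
  assumes "unit_level f j \<le> t"
  shows "rearrangement {0<..<1} f t \<le> ennreal (2 ^ j)"
proof (cases "j = 0")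
  \<comment> \<open>The conventional value \<open>1\<close> at level \<open>0\<close> turns the
    assumption into \<open>1 \<le> t\<close>, where the rearrangement vanishes.\<close>
  case True
  with assms show ?thesis by (simp add: level_def rearrangement_unit_eq_0)
next
  case False
  have "emeasure (lebesgue_on {0<..<1}) {x \<in> {0<..<1}. 2 ^ j < norm (f x)} \<le> ennreal t"
    unfolding emeasure_unit using assms False by (intro ennreal_leI) (simp add: level_def)
  then show ?thesis
    unfolding rearrangement_def by (intro Inf_lower) (auto intro!: exI[of _ "2 ^ j"])
qed

text \<open>At fixed \<open>t\<close> the weights of all levels exceeding \<open>t\<close> form part
  of a geometric sum, dominated by the largest such level \<open>J\<close>, and there the
  rearrangement is at least \<open>2 ^ J\<close>. Integrating \<open>t powr (q / p - 1)\<close> up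
  to each level value gives the terms of the sum. Level \<open>0\<close> is left out, its value
  being conventional.\<close>

lemma sum_level_le_lorentz_integral:
  fixes p q :: real and m :: nat and f :: "real \<Rightarrow> 'v::euclidean_space"
  assumes f: "f \<in> borel_measurable (lebesgue_on {0<..<1})" and pq: "0 < p" "0 < q"
  shows "ennreal ((1 - 2 powr - q) * (\<Sum>j\<in>{1..<m}. 2 powr (q * j) * unit_level f j powr (q / p) / (q / p)))
    \<le> (\<integral>\<^sup>+t\<in>{0<..}. lorentz_integrand p q {0<..<1} f t \<partial>lborel)"
proof -
  let ?s = "q / p" and ?c = "1 - 2 powr - q"
  have s: "0 < ?s" using pq by simp
  have x: "0 < 2 powr - q" "2 powr - q < 1"
    using pq powr_less_mono[of "- q" 0 2] by auto
  have c: "0 < ?c" using x by simp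
  have geo: "?c * (\<Sum>j\<le>J. 2 powr (q * real j)) \<le> 2 powr (q * real J)" for J
  proof -
    have "(\<Sum>j\<le>J. 2 powr (q * real j)) = (\<Sum>i\<le>J. 2 powr (q * J) * (2 powr - q) ^ i)"
      by (rule sum.reindex_bij_witness[of _ "\<lambda>i. J - i" "\<lambda>i. J - i"])
         (auto simp: of_nat_diff right_diff_distrib powr_diff powr_minus powr_realpow[symmetric] powr_powr field_simps)
    also have "\<dots> = 2 powr (q * J) * (\<Sum>i\<le>J. (2 powr - q) ^ i)" by (simp add: sum_distrib_left)
    also have "\<dots> \<le> 2 powr (q * J) * (\<Sum>i. (2 powr - q) ^ i)"
      using x by (intro mult_left_mono sum_le_suminf summable_geometric) auto
    also have "(\<Sum>i. (2 powr - q) ^ i) = 1 / ?c" using x by (intro suminf_geometric) auto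
    finally show ?thesis using c by (simp add: field_simps)
  qed
  let ?A = "\<lambda>t. {j \<in> {1..<m}. t < unit_level f j}"
  have pointwise: "ennreal (t powr (?s - 1) * (?c * (\<Sum>j\<in>?A t. 2 powr (q * j))))
      \<le> lorentz_integrand p q {0<..<1} f t" if t: "0 < t" for t
  proof (cases "rearrangement {0<..<1} f t")
    case top
    then have "lorentz_integrand p q {0<..<1} f t = top" using t by (intro lorentz_integrand_top)
    then show ?thesis by simp
  next
    case (real \<rho>)
    have "?c * (\<Sum>j\<in>?A t. 2 powr (q * j)) \<le> \<rho> powr q"
    proof (cases "?A t = {}")
      case True
      then show ?thesis by (simp only: sum.empty mult_zero_right powr_ge_zero)
    next
      case False
      define J where "J = Max (?A t)"
      have J: "J \<in> ?A t" unfolding J_def using False by (intro Max_in) auto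
      have "?A t \<subseteq> {..J}" unfolding J_def by (auto intro: Max_ge)
      then have "?c * (\<Sum>j\<in>?A t. 2 powr (q * j)) \<le> ?c * (\<Sum>j\<le>J. 2 powr (q * j))"
        using c by (intro mult_left_mono sum_mono2) auto
      also have "\<dots> \<le> 2 powr (q * J)" by (rule geo)
      also have "2 powr (q * J) = (2 ^ J) powr q"
        by (simp add: powr_powr mult.commute flip: powr_realpow)
      also have "\<dots> \<le> \<rho> powr q"
      proof (intro powr_mono2)
        have "ennreal (2 ^ J) \<le> ennreal \<rho>"
          using rearrangement_unit_ge[OF f, of J t] J t real by auto
        then show "2 ^ J \<le> \<rho>" using real by simp
      qed (use pq in auto)
      finally show ?thesis .
    qed
    then have "t powr (?s - 1) * (?c * (\<Sum>j\<in>?A t. 2 powr (q * j))) \<le> t powr (?s - 1) * \<rho> powr q"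
      by (intro mult_left_mono) auto
    then show ?thesis
      using lorentz_integrand_finite[of p q t "{0<..<1}" f \<rho>] pq t real by (simp add: ennreal_leI)
  qed
  have split: "ennreal (?c * (2 powr (q * j) * unit_level f j powr ?s / ?s))
      = ennreal (?c * 2 powr (q * j)) * ennreal (unit_level f j powr ?s / ?s)" for j :: nat
  proof -
    have "0 \<le> ?c * 2 powr (q * j)" "0 \<le> unit_level f j powr ?s / ?s"
      using c s by (auto intro: divide_nonneg_pos simp del: divide_divide_eq_right)
    from ennreal_mult[OF this] show ?thesis by (simp only: mult.assoc times_divide_eq_right)
  qed
  have "ennreal (?c * (\<Sum>j\<in>{1..<m}. 2 powr (q * j) * unit_level f j powr ?s / ?s))
      = (\<Sum>j\<in>{1..<m}. ennreal (?c * (2 powr (q * j) * unit_level f j powr ?s / ?s)))"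
    unfolding sum_distrib_left
    by (rule sum_ennreal[symmetric]) (intro mult_nonneg_nonneg divide_nonneg_nonneg; use pq c in simp)
  also have "\<dots> = (\<Sum>j\<in>{1..<m}. ennreal (?c * 2 powr (q * j)) * ennreal (unit_level f j powr ?s / ?s))"
    by (simp only: split)
  also have "\<dots> = (\<Sum>j\<in>{1..<m}. ennreal (?c * 2 powr (q * j)) *
      (\<integral>\<^sup>+t. ennreal (t powr (?s - 1)) * indicator {0<..<unit_level f j} t \<partial>lborel))"
    using s by (simp add: nn_integral_powr_interval unit.level_bounds)
  also have "\<dots> = (\<integral>\<^sup>+t. (\<Sum>j\<in>{1..<m}. ennreal (?c * 2 powr (q * j)) *
      (ennreal (t powr (?s - 1)) * indicator {0<..<unit_level f j} t)) \<partial>lborel)"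
    by (subst nn_integral_sum) (auto simp: nn_integral_cmult)
  also have "\<dots> \<le> (\<integral>\<^sup>+t. lorentz_integrand p q {0<..<1} f t * indicator {0<..} t \<partial>lborel)"
  proof (rule nn_integral_mono)
    fix t :: real
    show "(\<Sum>j\<in>{1..<m}. ennreal (?c * 2 powr (q * j)) *
        (ennreal (t powr (?s - 1)) * indicator {0<..<unit_level f j} t))
      \<le> lorentz_integrand p q {0<..<1} f t * indicator {0<..} t"
    proof (cases "0 < t")
      case False
      then show ?thesis by (simp add: indicator_def)
    next
      case True
      have "ennreal (?c * 2 powr (q * j)) * ennreal (t powr (?s - 1))
          = ennreal (t powr (?s - 1) * (?c * 2 powr (q * j)))" for j :: nat
        by (subst mult.commute) (rule ennreal_mult[symmetric]; use c in simp)
      then have "(\<Sum>j\<in>{1..<m}. ennreal (?c * 2 powr (q * j)) *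
          (ennreal (t powr (?s - 1)) * indicator {0<..<unit_level f j} t))
          = (\<Sum>j\<in>?A t. ennreal (t powr (?s - 1) * (?c * 2 powr (q * j))))"
        using True by (intro sum.mono_neutral_cong_right) (auto simp: indicator_def)
      also have "\<dots> = ennreal (t powr (?s - 1) * (?c * (\<Sum>j\<in>?A t. 2 powr (q * j))))"
        using c by (subst sum_ennreal) (auto simp: sum_distrib_left)
      also note pointwise[OF True]
      finally show ?thesis using True by simp
    qed
  qed
  finally show ?thesis .
qed

text \<open>For \<open>0 < t < 1\<close> let \<open>n\<close> be the first index whose level is at
  most \<open>t\<close>. Then the rearrangement is at most \<open>2 ^ n\<close>, while
  \<open>t\<close> lies below the level at \<open>n - 1\<close>, so the term at \<open>n - 1\<close>
  with weight shifted by one bounds the integrand. The value \<open>1\<close> at level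
  \<open>0\<close> ensures \<open>n \<noteq> 0\<close>.\<close>

lemma lorentz_integral_le_suminf_level:
  fixes p q :: real and f :: "real \<Rightarrow> 'v::euclidean_space"
  assumes pq: "0 < p" "0 < q"
    and summ: "summable (\<lambda>j. 2 powr (q * j) * unit_level f j powr (q / p))"
  shows "(\<integral>\<^sup>+t\<in>{0<..}. lorentz_integrand p q {0<..<1} f t \<partial>lborel)
    \<le> ennreal (2 powr q / (q / p) * (\<Sum>j. 2 powr (q * j) * unit_level f j powr (q / p)))"
proof -
  let ?s = "q / p"
  have s: "0 < ?s" using pq by simp
  let ?u = "\<lambda>j t. ennreal (2 powr (q * Suc j)) * (ennreal (t powr (?s - 1)) * indicator {0<..<unit_level f j} t)"
  have "(\<integral>\<^sup>+t\<in>{0<..}. lorentz_integrand p q {0<..<1} f t \<partial>lborel) \<le> (\<integral>\<^sup>+t. (\<Sum>j. ?u j t) \<partial>lborel)"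
  proof (rule nn_integral_mono)
    fix t :: real
    consider "t \<le> 0" | "1 \<le> t" | "0 < t" "t < 1" by linarith
    then show "lorentz_integrand p q {0<..<1} f t * indicator {0<..} t \<le> (\<Sum>j. ?u j t)"
    proof cases
      case 1
      then show ?thesis by simp
    next
      case 2
      then have "lorentz_integrand p q {0<..<1} f t = ennreal (t powr (?s - 1) * 0 powr q)"
        using pq rearrangement_unit_eq_0[of t f] by (intro lorentz_integrand_finite) auto
      then show ?thesis by simp
    next
      case 3
      \<comment> \<open>If all levels stayed above \<open>t\<close>, the terms of the convergent
        series would be at least \<open>t powr ?s\<close>, as the weights are at least
        \<open>1\<close>.\<close>
      have "\<exists>n. unit_level f n \<le> t"
      proof (rule ccontr)
        assume "\<nexists>n. unit_level f n \<le> t"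
        then have "t < unit_level f n" for n by (simp add: not_le)
        have "t powr ?s \<le> 2 powr (q * n) * unit_level f n powr ?s" for n
        proof -
          have "1 * t powr ?s \<le> 2 powr (q * n) * unit_level f n powr ?s"
            using \<open>\<And>n. t < unit_level f n\<close>[of n] s 3 pq
            by (intro mult_mono powr_mono2 ge_one_powr_ge_zero) auto
          then show ?thesis by simp
        qed
        then have "t powr ?s \<le> 0"
          by (intro LIMSEQ_le_const[OF summable_LIMSEQ_zero[OF summ]]) auto
        with 3 show False by simp
      qed
      define n where "n = (LEAST n. unit_level f n \<le> t)"
      have n: "unit_level f n \<le> t"
        unfolding n_def using \<open>\<exists>n. unit_level f n \<le> t\<close> by (rule LeastI_ex)
      have n0: "n \<noteq> 0" using n 3 by (intro notI) (simp add: level_def)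
      have n1: "t < unit_level f (n - 1)"
        using not_less_Least[of "n - 1" "\<lambda>n. unit_level f n \<le> t"] n0 by (auto simp: n_def not_le)
      have re: "rearrangement {0<..<1} f t \<le> ennreal (2 ^ n)" by (rule rearrangement_unit_le[OF n])
      then obtain \<rho> where \<rho>: "rearrangement {0<..<1} f t = ennreal \<rho>" "0 \<le> \<rho>"
        by (cases "rearrangement {0<..<1} f t") (auto simp: top_unique)
      with re have "\<rho> \<le> 2 ^ n" by simp
      then have "\<rho> powr q \<le> (2 ^ n) powr q" using \<rho> pq by (intro powr_mono2) auto
      also have "(2 ^ n) powr q = 2 powr (q * n)"
        by (simp add: powr_powr mult.commute flip: powr_realpow)
      finally have "ennreal (t powr (?s - 1) * \<rho> powr q) \<le> ennreal (t powr (?s - 1) * 2 powr (q * n))"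
        by (intro ennreal_leI mult_left_mono) auto
      also have "\<dots> = ?u (n - 1) t"
        using 3 n0 n1 by (simp add: ennreal_mult' mult.commute)
      also have "\<dots> \<le> (\<Sum>j. ?u j t)"
        using sum_le_suminf[of "\<lambda>j. ?u j t" "{n - 1}"] by simp
      finally show ?thesis using lorentz_integrand_finite[of p q t "{0<..<1}" f \<rho>] pq \<rho> 3 by simp
    qed
  qed
  also have "\<dots> = (\<Sum>j. \<integral>\<^sup>+t. ?u j t \<partial>lborel)" by (rule nn_integral_suminf) measurable
  also have "\<dots> = (\<Sum>j. ennreal (2 powr q / ?s * (2 powr (q * j) * unit_level f j powr ?s)))"
  proof (rule suminf_cong)
    fix j
    have "(\<integral>\<^sup>+t. ?u j t \<partial>lborel) = ennreal (2 powr (q * Suc j)) * ennreal (unit_level f j powr ?s / ?s)"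
      using s by (simp add: nn_integral_cmult nn_integral_powr_interval unit.level_bounds)
    also have "\<dots> = ennreal (2 powr (q * Suc j) * (unit_level f j powr ?s / ?s))"
      using s by (intro ennreal_mult[symmetric] divide_nonneg_pos) auto
    also have "2 powr (q * Suc j) * (unit_level f j powr ?s / ?s)
        = 2 powr q / ?s * (2 powr (q * j) * unit_level f j powr ?s)"
      by (simp add: distrib_left powr_add)
    finally show "(\<integral>\<^sup>+t. ?u j t \<partial>lborel) = ennreal (2 powr q / ?s * (2 powr (q * j) * unit_level f j powr ?s))" .
  qed
  also have "\<dots> = ennreal (\<Sum>j. 2 powr q / ?s * (2 powr (q * j) * unit_level f j powr ?s))"
    using s by (intro suminf_ennreal2 summable_mult summ mult_nonneg_nonneg divide_nonneg_pos) auto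
  also have "(\<Sum>j. 2 powr q / ?s * (2 powr (q * j) * unit_level f j powr ?s))
      = 2 powr q / ?s * (\<Sum>j. 2 powr (q * j) * unit_level f j powr ?s)"
    by (rule suminf_mult[OF summ])
  finally show ?thesis .
qed

section \<open>Embeddings of the half-line space\<close>

text \<open>Two-sided comparison of the norm with the dyadic sum on the unit interval. The additive
  \<open>1\<close> is the term at level \<open>0\<close>.\<close>

lemma unit_level_lorentz:
  fixes f :: "real \<Rightarrow> 'v::euclidean_space" and p q :: real
  assumes pq: "0 < p" "0 < q" and f: "f \<in> lorentz_functions p q {0<..<1}"
  defines "\<nu> \<equiv> enn2real (lorentz_norm p q {0<..<1} f)"
  shows "summable (\<lambda>j. 2 powr (q * j) * unit_level f j powr (q / p))"
    and "(\<Sum>j. 2 powr (q * j) * unit_level f j powr (q / p)) \<le> 1 + q / p / (1 - 2 powr - q) * \<nu> powr q"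
    and "\<nu> powr q \<le> 2 powr q / (q / p) * (\<Sum>j. 2 powr (q * j) * unit_level f j powr (q / p))"
proof -
  let ?s = "q / p" and ?c = "1 - 2 powr - q"
  have s: "0 < ?s" using pq by simp
  have c: "0 < ?c" using pq powr_less_mono[of "- q" 0 2] by simp
  have meas: "f \<in> borel_measurable (lebesgue_on {0<..<1})" and fin: "lorentz_norm p q {0<..<1} f < top"
    using f by (auto simp: lorentz_functions_def)
  have integral: "(\<integral>\<^sup>+t\<in>{0<..}. lorentz_integrand p q {0<..<1} f t \<partial>lborel) = ennreal (\<nu> powr q)"
    unfolding \<nu>_def by (rule lorentz_integral_finite[OF pq(2) fin])
  let ?u = "\<lambda>j. 2 powr (q * real j) * unit_level f j powr ?s"
  have bound: "(\<Sum>j<m. ?u j) \<le> 1 + ?s / ?c * \<nu> powr q" for m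
  proof (cases "m = 0")
    case True
    moreover have "0 \<le> ?s / ?c * \<nu> powr q"
      using pq c by (intro mult_nonneg_nonneg divide_nonneg_nonneg) auto
    ultimately show ?thesis by (simp only: lessThan_0 sum.empty)
  next
    case False
    have "ennreal (?c * (\<Sum>j\<in>{1..<m}. ?u j / ?s)) \<le> ennreal (\<nu> powr q)"
      unfolding integral[symmetric] by (rule sum_level_le_lorentz_integral[OF meas pq])
    then have "?c * ((\<Sum>j\<in>{1..<m}. ?u j) / ?s) \<le> \<nu> powr q"
      by (simp only: sum_divide_distrib ennreal_le_iff powr_ge_zero)
    then have "(\<Sum>j\<in>{1..<m}. ?u j) \<le> ?s / ?c * \<nu> powr q"
      using c pq by (simp add: field_simps)
    moreover have "(\<Sum>j<m. ?u j) = ?u 0 + (\<Sum>j\<in>{1..<m}. ?u j)"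
      using False by (simp add: lessThan_atLeast0 sum.atLeast_Suc_lessThan)
    moreover have "?u 0 = 1" by (simp add: level_def)
    ultimately show ?thesis by linarith
  qed
  show summ: "summable ?u"
    by (rule summableI_nonneg_bounded[OF _ bound]) simp
  show "suminf ?u \<le> 1 + ?s / ?c * \<nu> powr q"
    by (rule suminf_le_const[OF summ bound])
  have "0 \<le> suminf ?u" by (intro suminf_nonneg summ) simp
  then have "0 \<le> 2 powr q / ?s * suminf ?u" using s by (intro mult_nonneg_nonneg divide_nonneg_pos) auto
  with lorentz_integral_le_suminf_level[OF pq summ] show "\<nu> powr q \<le> 2 powr q / ?s * suminf ?u"
    unfolding integral by (simp only: ennreal_le_iff)
qed

section \<open>Norms of signed sums of unit indicators on the half-line\<close>

lemma rearrangement_unimodular: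
  assumes U: "\<And>x. x \<in> I \<Longrightarrow> norm (f x) = indicator U x" and m: "emeasure (lebesgue_on I) (I \<inter> U) = ennreal m"
    and "0 \<le> m" "0 \<le> t"
  shows "rearrangement I f t = (if t < m then 1 else 0)"
proof -
  have level: "emeasure (lebesgue_on I) {x \<in> I. l < norm (f x)} = (if l < 1 then ennreal m else 0)" if "0 < l" for l
  proof -
    have "x \<in> {x \<in> I. l < norm (f x)} \<longleftrightarrow> x \<in> (if l < 1 then I \<inter> U else {})" for x
      using U[of x] that by (cases "x \<in> U") auto
    then have "{x \<in> I. l < norm (f x)} = (if l < 1 then I \<inter> U else {})" by blast
    with m show ?thesis by simp
  qed
  show ?thesis
  proof (cases "t < m")
    case True
    have "rearrangement I f t = 1"
    proof (rule antisym)
      show "rearrangement I f t \<le> 1"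
        unfolding rearrangement_def by (rule Inf_lower) (use level[of 1] in \<open>auto intro!: exI[of _ 1]\<close>)
      show "1 \<le> rearrangement I f t"
        unfolding rearrangement_def
      proof (rule Inf_greatest, clarify)
        fix l :: real assume l: "0 < l" "emeasure (lebesgue_on I) {x \<in> I. l < norm (f x)} \<le> ennreal t"
        then have "1 \<le> l"
          using True level[of l] assms by (cases "l < 1") auto
        then show "1 \<le> ennreal l" by simp
      qed
    qed
    with True show ?thesis by simp
  next
    case False
    have "rearrangement I f t \<le> 0"
    proof (rule ennreal_le_epsilon)
      fix e :: real assume e: "0 < e"
      then have "rearrangement I f t \<le> ennreal e"
        unfolding rearrangement_def using False level[of e]
        by (intro Inf_lower) (auto intro!: exI[of _ e] ennreal_leI)
      then show "rearrangement I f t \<le> 0 + ennreal e" by simp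
    qed
    with False show ?thesis by simp
  qed
qed

lemma lorentz_norm_unimodular:
  assumes "\<And>x. x \<in> I \<Longrightarrow> norm (f x) = indicator U x" "emeasure (lebesgue_on I) (I \<inter> U) = ennreal m"
    and m: "0 \<le> m" and pq: "0 < p" "0 < q"
  shows "lorentz_norm p q I f = ennreal ((m powr (q / p) / (q / p)) powr (1 / q))"
proof -
  have "(\<integral>\<^sup>+t\<in>{0<..}. lorentz_integrand p q I f t \<partial>lborel)
      = (\<integral>\<^sup>+t. ennreal (t powr (q / p - 1)) * indicator {0<..<m} t \<partial>lborel)"
  proof (rule nn_integral_cong)
    fix t :: real
    show "lorentz_integrand p q I f t * indicator {0<..} t
        = ennreal (t powr (q / p - 1)) * indicator {0<..<m} t"
    proof (cases "0 < t")
      case True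
      then have "rearrangement I f t = ennreal (if t < m then 1 else 0)"
        using rearrangement_unimodular[OF assms(1,2) m, of t] by simp
      then have "lorentz_integrand p q I f t = ennreal (t powr (q / p - 1) * (if t < m then 1 else 0) powr q)"
        using pq True by (intro lorentz_integrand_finite) auto
      then show ?thesis using True by (simp add: indicator_def)
    qed simp
  qed
  also have "\<dots> = ennreal (m powr (q / p) / (q / p))"
    using pq m by (intro nn_integral_powr_interval) auto
  finally show ?thesis
    using pq by (simp add: lorentz_norm_eq ennreal_powr_ennreal)
qed

text \<open>Intervals open on the left and closed on the right are pairwise disjoint and stay inside
  the open half-line, also for \<open>n = 0\<close>.\<close>

definition unit_step :: "nat \<Rightarrow> real \<Rightarrow> 'k::{euclidean_space, real_normed_field}" where
  "unit_step n x = (if x \<in> {real n<..real n + 1} then 1 else 0)"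

lemma norm_signed_sum_unit_step:
  assumes "finite A"
  shows "norm (signed_sum A S (\<lambda>n. unit_step n x :: 'k::{euclidean_space, real_normed_field}))
    = indicator (\<Union>n\<in>A. {real n<..real n + 1}) x"
proof (cases "\<exists>n\<in>A. x \<in> {real n<..real n + 1}")
  case True
  then obtain n where n: "n \<in> A" "x \<in> {real n<..real n + 1}" by blast
  have "unit_step i x = (0::'k)" if "i \<noteq> n" for i
    using that n(2) by (cases "i < n") (auto simp: unit_step_def)
  then have "signed_sum (A - {n}) S (\<lambda>n. unit_step n x :: 'k) = 0"
    by (intro signed_sum_eq_0) auto
  then have "signed_sum A S (\<lambda>n. unit_step n x :: 'k) = (if n \<in> S then 1 else - 1)"
    using n assms by (simp add: signed_sum_def sum.remove[of A n] unit_step_def)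
  with True show ?thesis by (simp add: indicator_def)
next
  case False
  then have "signed_sum A S (\<lambda>n. unit_step n x :: 'k) = 0"
    by (intro signed_sum_eq_0) (auto simp: unit_step_def)
  with False show ?thesis by (simp add: indicator_def)
qed

lemma emeasure_Union_unit_intervals:
  assumes "finite A"
  shows "emeasure (lebesgue_on {0<..}) ({0<..} \<inter> (\<Union>n\<in>A. {real n<..real n + 1})) = ennreal (card A)"
proof -
  have "emeasure (lebesgue_on {0<..}) ({0<..} \<inter> (\<Union>n\<in>A. {real n<..real n + 1}))
      = emeasure lebesgue (\<Union>n\<in>A. {real n<..real n + 1})"
  proof (subst emeasure_restrict_space)
    have "{0<..} \<inter> (\<Union>n\<in>A. {real n<..real n + 1}) = (\<Union>n\<in>A. {real n<..real n + 1})" by force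
    then show "emeasure lebesgue ({0<..} \<inter> (\<Union>n\<in>A. {real n<..real n + 1}))
        = emeasure lebesgue (\<Union>n\<in>A. {real n<..real n + 1})" by (rule arg_cong)
  qed auto
  also have "\<dots> = (\<Sum>n\<in>A. emeasure lebesgue {real n<..real n + 1})"
  proof (rule sum_emeasure[symmetric])
    show "disjoint_family_on (\<lambda>n. {real n<..real n + 1}) A"
    proof (unfold disjoint_family_on_def, intro ballI impI)
      fix m n :: nat assume "m \<noteq> n"
      then show "{real m<..real m + 1} \<inter> {real n<..real n + 1} = {}"
        by (cases "m < n") auto
    qed
  qed (use assms in auto)
  also have "\<dots> = ennreal (card A)" by (simp add: ennreal_of_nat_eq_real_of_nat)
  finally show ?thesis .
qed

text \<open>Disjoint supports make the modulus the indicator of a set of measure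
  \<open>card A\<close> for every choice of signs, and the norm depends on the modulus
  alone.\<close>

lemma signed_sum_unit_step_lorentz:
  fixes p q :: real and A S :: "nat set"
  assumes "finite A" and pq: "0 < p" "0 < q"
  defines "f \<equiv> \<lambda>x. signed_sum A S (\<lambda>n. unit_step n x :: 'k::{euclidean_space, real_normed_field})"
  shows "f \<in> lorentz_functions p q {0<..}"
    and "enn2real (lorentz_norm p q {0<..} f) powr q = card A powr (q / p) / (q / p)"
proof -
  have eq: "lorentz_norm p q {0<..} f = ennreal ((card A powr (q / p) / (q / p)) powr (1 / q))"
    unfolding f_def using assms
    by (intro lorentz_norm_unimodular[OF norm_signed_sum_unit_step emeasure_Union_unit_intervals]) auto
  have "unit_step n \<in> borel_measurable (lebesgue_on {0<..})" for n
    unfolding unit_step_def by (intro measurable_restrict_space1 borel_measurable_if_I) auto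
  then have "f \<in> borel_measurable (lebesgue_on {0<..})"
    unfolding f_def by (rule borel_measurable_signed_sum)
  with eq show "f \<in> lorentz_functions p q {0<..}" by (simp add: lorentz_functions_def)
  show "enn2real (lorentz_norm p q {0<..} f) powr q = card A powr (q / p) / (q / p)"
    using pq by (simp add: eq powr_powr)
qed

text \<open>The structure of the spaces offers addition and scaling of classes only, so a sign is
  treated as scaling by \<open>1\<close> or \<open>- 1\<close>, and the empty sum as scaling by
  \<open>0\<close>.\<close>

lemma linear_map_signed_sum:
  fixes e y :: "nat \<Rightarrow> real \<Rightarrow> 'k::{euclidean_space, real_normed_field}"
  assumes lin: "linear_map_sp (lorentz_space p q I) (lorentz_space p q J) T"
    and e: "\<And>A S. finite A \<Longrightarrow> (\<lambda>t. signed_sum A S (\<lambda>n. e n t)) \<in> lorentz_functions p q I"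
    and y: "\<And>n. y n \<in> borel_measurable (lebesgue_on J)" "\<And>n. T (ae_class I (e n)) = ae_class J (y n)"
    and A: "finite A"
  shows "T (ae_class I (\<lambda>t. signed_sum A S (\<lambda>n. e n t))) = ae_class J (\<lambda>t. signed_sum A S (\<lambda>n. y n t))"
  using A
proof (induction A rule: finite_induct)
  have add: "T (plus_sp (lorentz_space p q I) a b) = plus_sp (lorentz_space p q J) (T a) (T b)"
    if "a \<in> points (lorentz_space p q I)" "b \<in> points (lorentz_space p q I)" for a b
    using lin that unfolding linear_map_sp_def by blast
  have scale: "T (scale_sp (lorentz_space p q I) c a) = scale_sp (lorentz_space p q J) c (T a)"
    if "a \<in> points (lorentz_space p q I)" for c a
    using lin that unfolding linear_map_sp_def by blast
  have points: "ae_class I f \<in> points (lorentz_space p q I)" if "f \<in> lorentz_functions p q I" for f :: "real \<Rightarrow> 'k"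
    using that by (simp add: lorentz_space_def)
  have meas: "f \<in> borel_measurable (lebesgue_on I)" if "f \<in> lorentz_functions p q I" for f :: "real \<Rightarrow> 'k"
    using that by (simp add: lorentz_functions_def)
  have single: "signed_sum {n} {n} (\<lambda>n. e n t) = e n t" for n t by (simp add: signed_sum_def)
  have e_n: "e n \<in> lorentz_functions p q I" for n
    using e[of "{n}" "{n}"] by (simp add: single)
  have T_scale: "T (ae_class I (\<lambda>t. c * e n t)) = ae_class J (\<lambda>t. c * y n t)" for c n
    using scale[OF points[OF e_n]] by (simp add: scale_lorentz_space meas[OF e_n] y)
  {
    case empty
    show ?case using T_scale[of 0] by simp
  next
    case (insert n A)
    define c :: 'k where "c = (if n \<in> S then 1 else - 1)"
    have split: "signed_sum (insert n A) S v = signed_sum A S v + c * v n" for v :: "nat \<Rightarrow> 'k"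
      using insert.hyps by (simp add: signed_sum_def c_def)
    have "signed_sum {n} S (\<lambda>n. e n t) = c * e n t" for t by (simp add: signed_sum_def c_def)
    then have ce: "(\<lambda>t. c * e n t) \<in> lorentz_functions p q I"
      using e[of "{n}" S] by simp
    note eA = e[OF insert.hyps(1), of S]
    have "T (ae_class I (\<lambda>t. signed_sum A S (\<lambda>n. e n t) + c * e n t))
        = T (plus_sp (lorentz_space p q I) (ae_class I (\<lambda>t. signed_sum A S (\<lambda>n. e n t))) (ae_class I (\<lambda>t. c * e n t)))"
      using meas[OF eA] meas[OF ce] by (simp add: plus_lorentz_space)
    also have "\<dots> = plus_sp (lorentz_space p q J) (ae_class J (\<lambda>t. signed_sum A S (\<lambda>n. y n t))) (ae_class J (\<lambda>t. c * y n t))"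
      using add[OF points[OF eA] points[OF ce]] insert.IH T_scale[of c n] by simp
    also have "\<dots> = ae_class J (\<lambda>t. signed_sum A S (\<lambda>n. y n t) + c * y n t)"
      using y(1) by (intro plus_lorentz_space borel_measurable_signed_sum borel_measurable_times) auto
    finally show ?case by (simp add: split)
  }
qed

text \<open>The norm is constant on classes. Through this, signed sums of the images acquire finite
  norm from the target of the map rather than from a quasi-triangle inequality.\<close>

lemma ae_class_in_points:
  assumes "f \<in> borel_measurable (lebesgue_on I)" "ae_class I f \<in> points (lorentz_space p q I)"
  shows "f \<in> lorentz_functions p q I"
proof -
  from assms(2) obtain g where g: "g \<in> lorentz_functions p q I" "ae_class I f = ae_class I g"
    by (auto simp: lorentz_space_def)
  with ae_class_self[OF assms(1)] have "f \<in> ae_class I g" by simp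
  then have "AE x in lebesgue_on I. f x = g x" unfolding ae_class_def by blast
  with g(1) assms(1) lorentz_norm_cong_AE[of f I g p q] show ?thesis
    by (simp add: lorentz_functions_def)
qed

lemma lorentz_halfline_not_embeds:
  fixes p q :: real
  assumes p: "0 < p" "p < 2" and q: "0 < q" and pq: "p \<noteq> q"
  shows "\<not> embeds_isomorphically
             (lorentz_space p q {0<..} :: ('k::{euclidean_space, real_normed_field}, (real \<Rightarrow> 'k) set) normed_sp)
             (lorentz_space p q {0<..<1})"
proof
  let ?X = "lorentz_space p q {0<..} :: ('k, (real \<Rightarrow> 'k) set) normed_sp"
  let ?Y = "lorentz_space p q {0<..<1} :: ('k, (real \<Rightarrow> 'k) set) normed_sp"
  let ?s = "q / p"
  have s: "0 < ?s" using p q by simp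
  assume "embeds_isomorphically ?X ?Y"
  then obtain T C where lin: "linear_map_sp ?X ?Y T" and C: "1 \<le> C"
    and T: "\<And>x. x \<in> points ?X \<Longrightarrow> inverse C * norm_sp ?X x \<le> norm_sp ?Y (T x)"
      "\<And>x. x \<in> points ?X \<Longrightarrow> norm_sp ?Y (T x) \<le> C * norm_sp ?X x"
    unfolding embeds_isomorphically_def isomorphic_embedding_sp_def by blast
  have TY: "T x \<in> points ?Y" if "x \<in> points ?X" for x
    using lin that unfolding linear_map_sp_def by blast
  let ?E = "\<lambda>A S t. signed_sum A S (\<lambda>n. unit_step n t) :: 'k"
  have E: "?E A S \<in> lorentz_functions p q {0<..}" if "finite A" for A S
    by (rule signed_sum_unit_step_lorentz[OF that p(1) q])
  have EX: "ae_class {0<..} (?E A S) \<in> points ?X" if "finite A" for A S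
    using E[OF that] by (simp add: lorentz_space_def)
  have "?E {n} {n} = unit_step n" for n by (simp add: signed_sum_def)
  then have "ae_class {0<..} (unit_step n) \<in> points ?X" for n
    using EX[of "{n}" "{n}"] by simp
  then have "T (ae_class {0<..} (unit_step n)) \<in> ae_class {0<..<1} ` lorentz_functions p q {0<..<1}" for n
    using TY[of "ae_class {0<..} (unit_step n)"] by (simp add: lorentz_space_def)
  then have "\<exists>y\<in>lorentz_functions p q {0<..<1}. T (ae_class {0<..} (unit_step n)) = ae_class {0<..<1} y" for n
    by blast
  then obtain y where y: "\<And>n. y n \<in> lorentz_functions p q {0<..<1}"
      "\<And>n. T (ae_class {0<..} (unit_step n)) = ae_class {0<..<1} (y n)"
    by metis
  have ym: "y n \<in> borel_measurable (lebesgue_on {0<..<1})" for n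
    using y(1) by (simp add: lorentz_functions_def)
  let ?F = "\<lambda>A S t. signed_sum A S (\<lambda>n. y n t)"
  define \<nu> where "\<nu> A S = enn2real (lorentz_norm p q {0<..<1} (?F A S))" for A S
  \<comment> \<open>The \<open>q\<close>-th power of the half-line norm of any signed sum of unit
    steps over \<open>A\<close>.\<close>
  define k where "k A = (real (card A) powr ?s / ?s)" for A :: "nat set"
  have F: "?F A S \<in> lorentz_functions p q {0<..<1}"
    and F_lower: "C powr - q * k A \<le> \<nu> A S powr q"
    and F_upper: "\<nu> A S powr q \<le> C powr q * k A" if A: "finite A" for A S
  proof -
    have TE: "T (ae_class {0<..} (?E A S)) = ae_class {0<..<1} (?F A S)"
      by (rule linear_map_signed_sum[OF lin E ym y(2) A])
    have Fm: "?F A S \<in> borel_measurable (lebesgue_on {0<..<1})"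
      using ym by (intro borel_measurable_signed_sum)
    have "ae_class {0<..<1} (?F A S) \<in> points ?Y"
      using TY[OF EX[OF A, of S]] TE by simp
    then show "?F A S \<in> lorentz_functions p q {0<..<1}"
      by (rule ae_class_in_points[OF Fm])
    have Em: "?E A S \<in> borel_measurable (lebesgue_on {0<..})"
      using E[OF A] by (simp add: lorentz_functions_def)
    define e where "e = enn2real (lorentz_norm p q {0<..} (?E A S))"
    have e: "0 \<le> e" "e powr q = k A"
      using signed_sum_unit_step_lorentz(2)[OF A p(1) q, of S] by (simp_all add: e_def k_def)
    have "inverse C * e \<le> \<nu> A S" "\<nu> A S \<le> C * e"
      using T[OF EX[OF A, of S]] unfolding TE norm_lorentz_space[OF Fm] norm_lorentz_space[OF Em] e_def \<nu>_def
      by simp_all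
    then have "(inverse C * e) powr q \<le> \<nu> A S powr q" "\<nu> A S powr q \<le> (C * e) powr q"
      using C e q by (auto intro!: powr_mono2 simp: \<nu>_def)
    moreover have "(inverse C * e) powr q = C powr - q * k A" "(C * e) powr q = C powr q * k A"
      using C e by (auto simp: powr_mult powr_minus inverse_powr)
    ultimately show "C powr - q * k A \<le> \<nu> A S powr q" "\<nu> A S powr q \<le> C powr q * k A" by simp_all
  qed
  let ?L = "\<lambda>A S. \<Sum>j. 2 powr (q * j) * unit_level (?F A S) j powr ?s"
  have c: "0 < 1 - 2 powr - q" using q powr_less_mono[of "- q" 0 2] by simp
  \<comment> \<open>The additive \<open>1\<close> is absorbed since
    \<open>card A powr ?s \<ge> 1\<close>. In both constants the factor \<open>?s\<close> of the
    norm comparison cancels against the one in \<open>k A\<close>.\<close>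
  define C' where "C' = 1 + C powr q / (1 - 2 powr - q)"
  define c' where "c' = C powr - q / 2 powr q"
  show False
  proof (rule unit.no_power_type_signed_sums[of y ?s q c' C'])
    show "y n \<in> borel_measurable (lebesgue_on {0<..<1})" for n by (rule ym)
    \<comment> \<open>Here \<open>p \<noteq> q\<close> becomes \<open>?s \<noteq> 1\<close>, and
      \<open>p < 2\<close> becomes the condition of the Hardy inequality.\<close>
    show "0 < ?s" "?s \<noteq> 1" "q < 2 * ?s" using p q pq by (auto simp: field_simps)
    show "0 < c'" using C by (simp add: c'_def)
    fix A S :: "nat set" assume A: "finite A" "A \<noteq> {}" "S \<subseteq> A"
    note L = unit_level_lorentz[OF p(1) q F[OF A(1), of S], folded \<nu>_def]
    show "summable (\<lambda>j. 2 powr (q * j) * unit_level (?F A S) j powr ?s)" by (rule L(1))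
    have "1 \<le> card A" using A by (simp add: Suc_le_eq card_gt_0_iff)
    then have one: "1 \<le> card A powr ?s" using s by (intro ge_one_powr_ge_zero) auto
    have "?L A S \<le> 1 + ?s / (1 - 2 powr - q) * \<nu> A S powr q" by (rule L(2))
    also have "\<dots> \<le> 1 + ?s / (1 - 2 powr - q) * (C powr q * k A)"
      using p q c by (intro add_left_mono mult_left_mono F_upper A divide_nonneg_nonneg) auto
    also have "\<dots> = 1 + C powr q / (1 - 2 powr - q) * card A powr ?s"
      using p q c by (simp add: k_def)
    also have "\<dots> \<le> C' * card A powr ?s"
      using one by (simp add: C'_def distrib_right)
    finally show "?L A S \<le> C' * card A powr ?s" .
    have "c' * card A powr ?s = ?s / 2 powr q * (C powr - q * k A)"
      using p q by (simp add: c'_def k_def)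
    also have "\<dots> \<le> ?s / 2 powr q * \<nu> A S powr q"
      using p q by (intro mult_left_mono F_lower A) auto
    also have "\<dots> \<le> ?s / 2 powr q * (2 powr q / ?s * ?L A S)"
      using p q by (intro mult_left_mono L(3)) auto
    also have "\<dots> = ?L A S" using p q by simp
    finally show "c' * card A powr ?s \<le> ?L A S" .
  qed
qed

theorem corollary5p1:
  fixes p q :: real
  assumes "0 < p" and "p < 2" and "0 < q" and "p \<noteq> q"
  shows "\<not> embeds_isomorphically
             (lorentz_space p q {0<..} :: ('k::{euclidean_space, real_normed_field}, (real \<Rightarrow> 'k) set) normed_sp)
             (lorentz_space p q {0<..<1})
       \<and> \<not> isomorphic_sp
             (lorentz_space p q {0<..} :: ('k, (real \<Rightarrow> 'k) set) normed_sp)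
             (lorentz_space p q {0<..<1})"
  using lorentz_halfline_not_embeds[OF assms, where 'k = 'k]
  unfolding isomorphic_sp_def embeds_isomorphically_def by blast

end
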